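(* Let $(g,c,n)$ be a v-admissible triplet of integers with $5\le g\le c\le n$ and $2c\ge g^2-2g+4$. If $g$ is even, then $g/4\le A(g,c,n)\le (g+4)/4$; if $g$ is odd, then $g/4\le A(g,c,n)\le (g+5)/4$.
   Context: All graphs are finite, simple and connected. A graph $G$ is regarded as a geodesic metric space by identifying each edge isometrically with $[0,1]$; points are vertices and interior points of edges, $d$ is the shortest-path length. A geodesic triangle $T=\{x,y,z\}$ is a union of three geodesics $[xy],[yz],[zx]$; $\delta(T)$ is the infimum of $\delta\ge0$ such that each side lies in the $\delta$-neighbourhood of the union of the other two; $\delta(G)=\sup_T\delta(T)$ over geodesic triangles. Girth $g(G)$ / circumference $c(G)$: length of a shortest / longest cycle. $\mathcal{G}(g,c,n)$ is the set of graphs with girth $g$, circumference $c$ and $n$ vertices, and $A(g,c,n)=\min\{\delta(G):G\in\mathcal{G}(g,c,n)\}$. A triplet $(g,c,n)$ is v-admissible if $\mathcal{G}(g,c,n)\ne\emptyset$. *)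

theory Defs
  imports Complex_Main "HOL-Library.Extended_Nat" "HOL-Library.Indicator_Function"
begin

section \<open>Gromov hyperbolicity constant of a metric space\<close>

text \<open>Metric spaces are given by a carrier \<open>M\<close> and a distance function \<open>d\<close>.
  A geodesic from \<open>x\<close> to \<open>y\<close> is the image of an isometric embedding of
  an interval of length \<open>d x y\<close>; it need not be unique.\<close>

definition geodesic :: "'p set \<Rightarrow> ('p \<Rightarrow> 'p \<Rightarrow> real) \<Rightarrow> 'p \<Rightarrow> 'p \<Rightarrow> 'p set \<Rightarrow> bool" where
  "geodesic M d x y S \<longleftrightarrow>
     S \<subseteq> M \<and>
     (\<exists>\<gamma>. \<gamma> 0 = x \<and> \<gamma> (d x y) = y \<and> \<gamma> ` {0..d x y} = S \<and>
          (\<forall>s\<in>{0..d x y}. \<forall>t\<in>{0..d x y}. d (\<gamma> s) (\<gamma> t) = \<bar>s - t\<bar>))"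

definition geodesic_triangle ::
  "'p set \<Rightarrow> ('p \<Rightarrow> 'p \<Rightarrow> real) \<Rightarrow> 'p set \<Rightarrow> 'p set \<Rightarrow> 'p set \<Rightarrow> bool" where
  "geodesic_triangle M d A B C \<longleftrightarrow>
     (\<exists>x\<in>M. \<exists>y\<in>M. \<exists>z\<in>M. geodesic M d x y A \<and> geodesic M d y z B \<and> geodesic M d z x C)"

definition nbhd :: "'p set \<Rightarrow> ('p \<Rightarrow> 'p \<Rightarrow> real) \<Rightarrow> real \<Rightarrow> 'p set \<Rightarrow> 'p set" where
  "nbhd M d r S = {p \<in> M. \<exists>q\<in>S. d p q \<le> r}"

definition triangle_delta ::
  "'p set \<Rightarrow> ('p \<Rightarrow> 'p \<Rightarrow> real) \<Rightarrow> 'p set \<Rightarrow> 'p set \<Rightarrow> 'p set \<Rightarrow> real" where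
  "triangle_delta M d A B C =
     Inf {r. 0 \<le> r \<and> A \<subseteq> nbhd M d r (B \<union> C) \<and> B \<subseteq> nbhd M d r (C \<union> A) \<and> C \<subseteq> nbhd M d r (A \<union> B)}"

text \<open>The supremum is taken in the reals: it is only used for metric graphs of finite
  graphs, whose finite diameter bounds all the \<open>triangle_delta\<close>.\<close>

definition hyperbolicity_constant :: "'p set \<Rightarrow> ('p \<Rightarrow> 'p \<Rightarrow> real) \<Rightarrow> real" where
  "hyperbolicity_constant M d =
     Sup {triangle_delta M d A B C | A B C. geodesic_triangle M d A B C}"

section \<open>Finite simple graphs\<close>

text \<open>A graph is a pair of a vertex set and a set of two-element sets of vertices.\<close>

type_synonym 'a graph = "'a set \<times> 'a set set"

definition simple_graph :: "'a graph \<Rightarrow> bool" where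
  "simple_graph G \<longleftrightarrow>
     finite (fst G) \<and> snd G \<subseteq> {{u, v} | u v. u \<in> fst G \<and> v \<in> fst G \<and> u \<noteq> v}"

definition connected_graph :: "'a graph \<Rightarrow> bool" where
  "connected_graph G \<longleftrightarrow>
     fst G \<noteq> {} \<and> (\<forall>u\<in>fst G. \<forall>v\<in>fst G. (u, v) \<in> {(x, y). {x, y} \<in> snd G}\<^sup>*)"

text \<open>A cycle is listed without repeating its first vertex, so that its length is the
  length of the list.\<close>

definition is_cycle :: "'a graph \<Rightarrow> 'a list \<Rightarrow> bool" where
  "is_cycle G vs \<longleftrightarrow>
     3 \<le> length vs \<and> distinct vs \<and>
     (\<forall>i<length vs. {vs ! i, vs ! (Suc i mod length vs)} \<in> snd G)"

text \<open>An acyclic graph has girth \<open>\<infinity>\<close>.\<close>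

definition girth :: "'a graph \<Rightarrow> enat" where
  "girth G = (INF vs\<in>{vs. is_cycle G vs}. enat (length vs))"

definition circumference :: "'a graph \<Rightarrow> enat" where
  "circumference G = (SUP vs\<in>{vs. is_cycle G vs}. enat (length vs))"

section \<open>Graphs as metric spaces\<close>

text \<open>Points are represented by their barycentric coordinates: \<open>edge_point u v t\<close> is the
  point at distance \<open>t\<close> from \<open>u\<close> on the edge \<open>{u, v}\<close>, and \<open>edge_point v v 0\<close> is the
  vertex \<open>v\<close>. In particular \<open>edge_point u v t = edge_point v u (1 - t)\<close>, and edges with a
  common end are glued there.\<close>

definition edge_point :: "'a \<Rightarrow> 'a \<Rightarrow> real \<Rightarrow> ('a \<Rightarrow> real)" where
  "edge_point u v t = (\<lambda>w. (1 - t) * indicator {u} w + t * indicator {v} w)"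

definition graph_points :: "'a graph \<Rightarrow> ('a \<Rightarrow> real) set" where
  "graph_points G =
     {edge_point v v 0 | v. v \<in> fst G} \<union>
     {edge_point u v t | u v t. {u, v} \<in> snd G \<and> 0 \<le> t \<and> t \<le> 1}"

text \<open>\<open>path_length G p q l\<close>: some path that runs through finitely many segments, each
  contained in a single edge, joins \<open>p\<close> to \<open>q\<close> and has length \<open>l\<close>.\<close>

inductive path_length :: "'a graph \<Rightarrow> ('a \<Rightarrow> real) \<Rightarrow> ('a \<Rightarrow> real) \<Rightarrow> real \<Rightarrow> bool"
  for G :: "'a graph" and p :: "'a \<Rightarrow> real" where
  refl: "path_length G p p 0"
| step: "path_length G p (edge_point u v s) l \<Longrightarrow> {u, v} \<in> snd G \<Longrightarrow>
         s \<in> {0..1} \<Longrightarrow> t \<in> {0..1} \<Longrightarrow>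
         path_length G p (edge_point u v t) (l + \<bar>s - t\<bar>)"

definition graph_dist :: "'a graph \<Rightarrow> ('a \<Rightarrow> real) \<Rightarrow> ('a \<Rightarrow> real) \<Rightarrow> real" where
  "graph_dist G p q = Inf {l. path_length G p q l}"

definition graph_delta :: "'a graph \<Rightarrow> real" where
  "graph_delta G = hyperbolicity_constant (graph_points G) (graph_dist G)"

section \<open>Minimal hyperbolicity constant for given girth, circumference and order\<close>

text \<open>Graphs are taken up to isomorphism, on the vertex set \<open>{..<n}\<close>; this makes the
  class a finite set, so that the minimum below is a genuine one whenever the class is
  nonempty.\<close>

definition graph_class :: "nat \<Rightarrow> nat \<Rightarrow> nat \<Rightarrow> nat graph set" where
  "graph_class g c n =
     {G. simple_graph G \<and> connected_graph G \<and> fst G = {..<n} \<and>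
         girth G = enat g \<and> circumference G = enat c}"

definition v_admissible :: "nat \<Rightarrow> nat \<Rightarrow> nat \<Rightarrow> bool" where
  "v_admissible g c n \<longleftrightarrow> graph_class g c n \<noteq> {}"

definition min_delta :: "nat \<Rightarrow> nat \<Rightarrow> nat \<Rightarrow> real" where
  "min_delta g c n = Min (graph_delta ` graph_class g c n)"

lemma finite_graph_class: "finite (graph_class g c n)"
proof (rule finite_subset)
  show "graph_class g c n \<subseteq> {{..<n}} \<times> Pow (Pow {..<n})"
    by (auto simp: graph_class_def simple_graph_def)
qed simp

end

theory Submission imports Defs "HOL-Analysis.Elementary_Metric_Spaces" begin

text \<open>Lower bound: a shortest cycle is isometrically embedded, because a shortcut between two of its
  vertices would close up to a shorter cycle. Its two halves between antipodal points
  therefore form a geodesic bigon, and the midpoint of one half is at distance \<open>g/4\<close> from the other.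

  Upper bound: glue cycles of lengths in \<open>{g, g + 1, g + 2}\<close> into a fan in which they all share a hub
  and neighbouring cycles share an edge (a spoke); the rim and the two outermost spokes form a longest
  cycle. The bound on \<open>c\<close> suffices to write \<open>c - 2\<close> as a sum of numbers from
  \<open>{g - 2, g - 1, g}\<close>, one of them equal to \<open>g - 2\<close>. Spokes separate the fan. If a side of a
  geodesic triangle joins points \<open>x, y\<close> in different cycles, it crosses a spoke bounding the cycle of \<open>x\<close>,
  hence at distance at most \<open>(g + 2)/2\<close> from \<open>x\<close>, and the union of the other two sides crosses the
  same spoke, hence within distance 1 of that point; likewise near \<open>y\<close>. This bounds the distance from the side to
  the other two by \<open>((g + 2)/2 + 1)/2 = (g + 4)/4\<close>, which covers both parities.\<close>

section \<open>The path metric of a graph\<close>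

lemma edge_point_swap: "edge_point u v t = edge_point v u (1 - t)"
  by (auto simp: edge_point_def)

lemma edge_point_0: "edge_point u v 0 = edge_point u u 0"
  by (auto simp: edge_point_def)

lemma edge_point_1: "edge_point u v 1 = edge_point v v 0"
  by (auto simp: edge_point_def)

definition segment :: "'a \<Rightarrow> 'a \<Rightarrow> ('a \<Rightarrow> real) set" where
  "segment u v = edge_point u v ` {0..1}"

lemma segmentE:
  assumes "p \<in> segment u v"
  obtains t where "0 \<le> t" "t \<le> 1" "p = edge_point u v t"
  using assms by (auto simp: segment_def)

lemma segment_commute: "segment u v = segment v u"
proof -
  have "segment u v \<subseteq> segment v u" for u v :: 'a
  proof
    fix p assume "p \<in> segment u v"
    then obtain t where "0 \<le> t" "t \<le> 1" "p = edge_point u v t" by (rule segmentE)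
    then have "p = edge_point v u (1 - t)" "1 - t \<in> {0..1}"
      using edge_point_swap by fastforce+
    then show "p \<in> segment v u" unfolding segment_def by (rule image_eqI)
  qed
  then show ?thesis by blast
qed

lemma left_in_segment: "edge_point u u 0 \<in> segment u v"
  unfolding segment_def edge_point_0[of u v, symmetric] by (rule imageI) simp

lemma right_in_segment: "edge_point v v 0 \<in> segment u v"
  using left_in_segment segment_commute by metis

section \<open>Lengths of paths and the distance they define\<close>

lemma path_length_edge:
  assumes "{u, v} \<in> snd G" "s \<in> {0..1}" "t \<in> {0..1}"
  shows "path_length G (edge_point u v s) (edge_point u v t) \<bar>s - t\<bar>"
  using path_length.step[OF path_length.refl assms] by simp

lemma path_length_trans:
  assumes "path_length G q r l'" "path_length G p q l"
  shows "path_length G p r (l + l')"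
  using assms
proof (induction rule: path_length.induct)
  case (step u v s l1 t)
  from path_length.step[OF step.IH[OF step.prems] step.hyps(2-4)] show ?case
    by (simp add: add.assoc)
qed simp

lemma path_length_sym: "path_length G p q l \<Longrightarrow> path_length G q p l"
proof (induction rule: path_length.induct)
  case refl
  show ?case by (rule path_length.refl)
next
  case (step u v s l t)
  have "path_length G (edge_point u v t) (edge_point u v s) \<bar>t - s\<bar>"
    using step by (intro path_length_edge)
  from path_length_trans[OF step.IH this] show ?case
    by (simp add: abs_minus_commute add.commute)
qed

text \<open>Each step of a path stays in one edge, so a bound on edges telescopes along the path.
  Lower bounds on distances come from suitable functions \<open>F\<close>, which avoids minimising
  over paths.\<close>

lemma path_length_lipschitz:
  assumes "path_length G p q l"
    and "\<And>u v s t. {u, v} \<in> snd G \<Longrightarrow> s \<in> {0..1} \<Longrightarrow> t \<in> {0..1} \<Longrightarrow>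
           \<bar>F (edge_point u v s) - F (edge_point u v t)\<bar> \<le> \<bar>s - t\<bar>"
  shows "\<bar>F p - F q\<bar> \<le> (l :: real)"
  using assms(1)
proof (induction rule: path_length.induct)
  case (step u v s l t)
  then show ?case using assms(2)[of u v s t] by linarith
qed simp

lemma path_length_nonneg: "path_length G p q l \<Longrightarrow> 0 \<le> l"
  using path_length_lipschitz[of G p q l "\<lambda>_. 0"] by simp

lemma graph_dist_le: "path_length G p q l \<Longrightarrow> graph_dist G p q \<le> l"
  unfolding graph_dist_def
  by (rule cInf_lower) (auto intro!: bdd_belowI[of _ 0] path_length_nonneg)

lemma graph_dist_commute: "graph_dist G p q = graph_dist G q p"
proof -
  have "path_length G p q = path_length G q p"
    by (intro ext iffI) (erule path_length_sym)+
  then show ?thesis by (simp add: graph_dist_def)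
qed

text \<open>Points are vectors of barycentric coordinates, so this weighted sum is the affine
  interpolation along edges of the vertex function \<open>f\<close>.\<close>

definition potential :: "'a graph \<Rightarrow> ('a \<Rightarrow> real) \<Rightarrow> ('a \<Rightarrow> real) \<Rightarrow> real" where
  "potential G f p = (\<Sum>w\<in>fst G. f w * p w)"

locale finite_connected_graph =
  fixes G :: "'a graph"
  assumes simple: "simple_graph G" and connected: "connected_graph G"
begin

lemma finite_V: "finite (fst G)"
  using simple by (simp add: simple_graph_def)

lemma edgeD:
  assumes "{u, v} \<in> snd G"
  shows "u \<in> fst G" "v \<in> fst G" "u \<noteq> v"
proof -
  obtain x y where "{u, v} = {x, y}" "x \<in> fst G" "y \<in> fst G" "x \<noteq> y"
    using simple assms unfolding simple_graph_def by blast
  then show "u \<in> fst G" "v \<in> fst G" "u \<noteq> v" by (auto simp: doubleton_eq_iff)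
qed

lemma vertex_point: "v \<in> fst G \<Longrightarrow> edge_point v v 0 \<in> graph_points G"
  by (auto simp: graph_points_def)

lemma edge_point_in: "{u, v} \<in> snd G \<Longrightarrow> 0 \<le> t \<Longrightarrow> t \<le> 1 \<Longrightarrow> edge_point u v t \<in> graph_points G"
  by (auto simp: graph_points_def)

lemma graph_pointsE:
  assumes "p \<in> graph_points G"
  obtains v where "v \<in> fst G" "p = edge_point v v 0"
    | u v where "{u, v} \<in> snd G" "p \<in> segment u v"
  using assms by (fastforce simp: graph_points_def segment_def)

lemma path_length_walk:
  assumes "(u, v) \<in> {(x, y). {x, y} \<in> snd G} ^^ k"
  shows "path_length G (edge_point u u 0) (edge_point v v 0) k"
  using assms
proof (induction k arbitrary: v)
  case 0
  then show ?case by (simp add: path_length.refl)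
next
  case (Suc k)
  then obtain w where w: "(u, w) \<in> {(x, y). {x, y} \<in> snd G} ^^ k" "{w, v} \<in> snd G" by auto
  have "path_length G (edge_point w v 0) (edge_point w v 1) \<bar>0 - 1\<bar>"
    using w by (intro path_length_edge) auto
  then show ?case
    using path_length_trans[OF _ Suc.IH[OF w(1)]] edge_point_0[of w v] edge_point_1[of w v]
    by (auto simp: add.commute)
qed

lemma walk_exists:
  assumes "u \<in> fst G" "v \<in> fst G"
  shows "\<exists>k. (u, v) \<in> {(x, y). {x, y} \<in> snd G} ^^ k"
  using connected assms unfolding connected_graph_def by (meson rtrancl_imp_relpow)

definition walk_dist :: "'a \<Rightarrow> 'a \<Rightarrow> nat" where
  "walk_dist u v = (LEAST k. (u, v) \<in> {(x, y). {x, y} \<in> snd G} ^^ k)"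

lemma walk_dist:
  "u \<in> fst G \<Longrightarrow> v \<in> fst G \<Longrightarrow> (u, v) \<in> {(x, y). {x, y} \<in> snd G} ^^ walk_dist u v"
  unfolding walk_dist_def by (rule LeastI_ex[OF walk_exists])

lemma walk_dist_le: "(u, v) \<in> {(x, y). {x, y} \<in> snd G} ^^ k \<Longrightarrow> walk_dist u v \<le> k"
  unfolding walk_dist_def by (rule Least_le)

lemma path_length_vertex:
  assumes "p \<in> graph_points G"
  obtains u l where "u \<in> fst G" "l \<le> 1" "path_length G p (edge_point u u 0) l"
  using assms
proof (cases rule: graph_pointsE)
  case (1 v)
  then show ?thesis using that[of v 0] by (simp add: path_length.refl)
next
  case (2 u v)
  then obtain t where t: "0 \<le> t" "t \<le> 1" "p = edge_point u v t" by (elim segmentE)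
  have "path_length G p (edge_point u v 0) \<bar>t - 0\<bar>"
    unfolding t(3) using 2(1) t by (intro path_length_edge) auto
  then show ?thesis using that[of u t] t edgeD[OF 2(1)] edge_point_0[of u v] by auto
qed

text \<open>Both ends reach a vertex within 1, and finitely many pairs of vertices remain. This
  makes the real infimum in \<open>graph_dist\<close> one over a nonempty set, and the supremum in
  \<open>graph_delta\<close> one over a bounded set.\<close>

lemma path_length_bound:
  "\<exists>D::real. \<forall>p\<in>graph_points G. \<forall>q\<in>graph_points G. \<exists>l\<le>D. path_length G p q l"
proof -
  define D where "D = Max ((\<lambda>(u, v). walk_dist u v) ` (fst G \<times> fst G))"
  have D: "walk_dist u v \<le> D" if "u \<in> fst G" "v \<in> fst G" for u v
    unfolding D_def using that finite_V by (intro Max_ge) (auto intro!: image_eqI[of _ _ "(u, v)"])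
  show ?thesis
  proof (rule exI[of _ "real D + 2"], intro ballI)
    fix p q assume "p \<in> graph_points G" "q \<in> graph_points G"
    then obtain u l v m where u: "u \<in> fst G" "l \<le> 1" "path_length G p (edge_point u u 0) l"
      and v: "v \<in> fst G" "m \<le> 1" "path_length G q (edge_point v v 0) m"
      by (elim path_length_vertex)
    have "path_length G p q ((l + walk_dist u v) + m)"
      by (rule path_length_trans[OF path_length_sym[OF v(3)]
            path_length_trans[OF path_length_walk[OF walk_dist[OF u(1) v(1)]] u(3)]])
    then show "\<exists>l\<le>real D + 2. path_length G p q l"
      using u v D[of u v] by (intro exI[of _ "(l + walk_dist u v) + m"]) simp
  qed
qed

lemma path_length_exists: "p \<in> graph_points G \<Longrightarrow> q \<in> graph_points G \<Longrightarrow> \<exists>l. path_length G p q l"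
  using path_length_bound by blast

lemma graph_dist_ge:
  assumes "p \<in> graph_points G" "q \<in> graph_points G" "\<And>l. path_length G p q l \<Longrightarrow> c \<le> l"
  shows "c \<le> graph_dist G p q"
  unfolding graph_dist_def using assms path_length_exists by (intro cInf_greatest) auto

lemma graph_dist_lipschitz:
  assumes "p \<in> graph_points G" "q \<in> graph_points G"
    and "\<And>u v s t. {u, v} \<in> snd G \<Longrightarrow> s \<in> {0..1} \<Longrightarrow> t \<in> {0..1} \<Longrightarrow>
           \<bar>F (edge_point u v s) - F (edge_point u v t)\<bar> \<le> \<bar>s - t\<bar>"
  shows "\<bar>F p - F q\<bar> \<le> graph_dist G p q"
  using assms path_length_lipschitz[where F = F] by (intro graph_dist_ge) blast+

lemma graph_dist_nonneg:
  "p \<in> graph_points G \<Longrightarrow> q \<in> graph_points G \<Longrightarrow> 0 \<le> graph_dist G p q"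
  by (rule graph_dist_ge) (auto intro: path_length_nonneg)

lemma graph_dist_self: "p \<in> graph_points G \<Longrightarrow> graph_dist G p p = 0"
  using graph_dist_le[OF path_length.refl, of G p] graph_dist_nonneg[of p p] by simp

lemma graph_dist_triangle:
  assumes "p \<in> graph_points G" "q \<in> graph_points G" "r \<in> graph_points G"
  shows "graph_dist G p r \<le> graph_dist G p q + graph_dist G q r"
proof -
  \<comment> \<open>The two infima are taken one after the other: first over paths from
    \<open>q\<close> to \<open>r\<close> with the path from \<open>p\<close> to \<open>q\<close>
    fixed, then over the latter.\<close>
  have "graph_dist G p r - graph_dist G q r \<le> l" if l: "path_length G p q l" for l
  proof -
    have "graph_dist G p r - l \<le> graph_dist G q r"
    proof (rule graph_dist_ge[OF assms(2,3)])
      fix m assume "path_length G q r m"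
      from graph_dist_le[OF path_length_trans[OF this l]] show "graph_dist G p r - l \<le> m" by simp
    qed
    then show ?thesis by simp
  qed
  from graph_dist_ge[OF assms(1,2) this] show ?thesis by simp
qed

lemma graph_dist_bounded:
  "\<exists>D\<ge>0. \<forall>p\<in>graph_points G. \<forall>q\<in>graph_points G. graph_dist G p q \<le> D"
proof -
  obtain D where D: "\<And>p q. p \<in> graph_points G \<Longrightarrow> q \<in> graph_points G \<Longrightarrow> \<exists>l\<le>D. path_length G p q l"
    using path_length_bound by blast
  show ?thesis
  proof (rule exI[of _ "max 0 D"], intro conjI ballI)
    fix p q assume "p \<in> graph_points G" "q \<in> graph_points G"
    with D obtain l where "l \<le> D" "path_length G p q l" by blast
    with graph_dist_le[of G p q l] show "graph_dist G p q \<le> max 0 D" by linarith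
  qed simp
qed

lemma graph_dist_segment:
  assumes "{u, v} \<in> snd G" "p \<in> segment u v" "q \<in> segment u v"
  shows "graph_dist G p q \<le> 1"
proof -
  obtain s t where "0 \<le> s" "s \<le> 1" "p = edge_point u v s" "0 \<le> t" "t \<le> 1" "q = edge_point u v t"
    using assms by (meson segmentE)
  with graph_dist_le[OF path_length_edge[OF assms(1), of s t]] show ?thesis by auto
qed

lemma segment_subset: "{u, v} \<in> snd G \<Longrightarrow> segment u v \<subseteq> graph_points G"
  by (auto simp: segment_def edge_point_in)

lemma potential_edge_point:
  assumes "u \<in> fst G" "v \<in> fst G"
  shows "potential G f (edge_point u v t) = (1 - t) * f u + t * f v"
proof -
  have "potential G f (edge_point u v t) =
      (1 - t) * (\<Sum>w\<in>fst G. if w = u then f w else 0) + t * (\<Sum>w\<in>fst G. if w = v then f w else 0)"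
    unfolding potential_def edge_point_def sum_distrib_left sum.distrib[symmetric]
    by (rule sum.cong) (auto simp: algebra_simps indicator_def)
  then show ?thesis using assms finite_V by (simp add: sum.delta)
qed

text \<open>Along an edge the interpolation has slope \<open>f v - f u\<close>, so it suffices that
  \<open>f\<close> changes by at most 1 across each edge.\<close>

lemma potential_lipschitz:
  assumes "p \<in> graph_points G" "q \<in> graph_points G"
    and "\<And>u v. {u, v} \<in> snd G \<Longrightarrow> \<bar>f u - f v\<bar> \<le> 1"
  shows "\<bar>potential G f p - potential G f q\<bar> \<le> graph_dist G p q"
proof (rule graph_dist_lipschitz[OF assms(1,2)])
  fix u v and s t :: real assume e: "{u, v} \<in> snd G"
  have "potential G f (edge_point u v s) - potential G f (edge_point u v t) = (s - t) * (f v - f u)"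
    using edgeD[OF e] by (simp add: potential_edge_point algebra_simps)
  moreover have "\<bar>(s - t) * (f v - f u)\<bar> \<le> \<bar>s - t\<bar> * 1"
    unfolding abs_mult using assms(3)[OF e] by (intro mult_left_mono) auto
  ultimately show "\<bar>potential G f (edge_point u v s) - potential G f (edge_point u v t)\<bar> \<le> \<bar>s - t\<bar>"
    by simp
qed

end

section \<open>Geodesics\<close>

lemma geodesic_subset: "geodesic M d x y S \<Longrightarrow> S \<subseteq> M"
  by (simp add: geodesic_def)

lemma geodesic_ends:
  assumes "geodesic M d x y S" "0 \<le> d x y"
  shows "x \<in> S" "y \<in> S"
proof -
  obtain \<gamma> where "\<gamma> 0 = x" "\<gamma> (d x y) = y" "\<gamma> ` {0..d x y} = S"
    using assms(1) unfolding geodesic_def by blast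
  moreover have "0 \<in> {0..d x y}" "d x y \<in> {0..d x y}" using assms(2) by auto
  ultimately show "x \<in> S" "y \<in> S" by (metis imageI)+
qed

text \<open>Along the geodesic \<open>F\<close> is 1-Lipschitz, hence continuous, and the
  intermediate value theorem applies. It will force geodesics to cross a separating set, the zero
  set of \<open>F\<close>.\<close>

lemma geodesic_zero:
  fixes F :: "'p \<Rightarrow> real"
  assumes geo: "geodesic M d x y S" and d0: "0 \<le> d x y"
    and lip: "\<And>p q. p \<in> M \<Longrightarrow> q \<in> M \<Longrightarrow> \<bar>F p - F q\<bar> \<le> d p q"
    and sep: "F x \<le> 0 \<and> 0 \<le> F y \<or> F y \<le> 0 \<and> 0 \<le> F x"
  shows "\<exists>q\<in>S. F q = 0"
proof -
  obtain \<gamma> where \<gamma>: "\<gamma> 0 = x" "\<gamma> (d x y) = y" "\<gamma> ` {0..d x y} = S"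
    and iso: "\<And>s t. s \<in> {0..d x y} \<Longrightarrow> t \<in> {0..d x y} \<Longrightarrow> d (\<gamma> s) (\<gamma> t) = \<bar>s - t\<bar>"
    using geo unfolding geodesic_def by blast
  have mem: "\<gamma> s \<in> M" if "s \<in> {0..d x y}" for s
    using geodesic_subset[OF geo] \<gamma>(3) that by blast
  have cont: "continuous_on {0..d x y} (\<lambda>s. F (\<gamma> s))"
    unfolding continuous_on_iff dist_real_def
  proof (intro ballI allI impI)
    fix s and e :: real assume s: "s \<in> {0..d x y}" and "0 < e"
    have "\<bar>F (\<gamma> t) - F (\<gamma> s)\<bar> \<le> \<bar>t - s\<bar>" if "t \<in> {0..d x y}" for t
      using lip[OF mem[OF that] mem[OF s]] iso[OF that s] by simp
    then show "\<exists>\<delta>>0. \<forall>t\<in>{0..d x y}. \<bar>t - s\<bar> < \<delta> \<longrightarrow> \<bar>F (\<gamma> t) - F (\<gamma> s)\<bar> < e"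
      using \<open>0 < e\<close> by (meson le_less_trans)
  qed
  have "\<exists>s\<ge>0. s \<le> d x y \<and> F (\<gamma> s) = 0"
    using sep
  proof
    assume "F x \<le> 0 \<and> 0 \<le> F y"
    then show ?thesis using IVT'[OF _ _ d0 cont, of 0] \<gamma> by auto
  next
    assume "F y \<le> 0 \<and> 0 \<le> F x"
    then show ?thesis using IVT2'[OF _ _ d0 cont, of 0] \<gamma> by auto
  qed
  then show ?thesis using \<gamma>(3) by fastforce
qed

context finite_connected_graph
begin

lemma geodesic_self: "p \<in> graph_points G \<Longrightarrow> geodesic (graph_points G) (graph_dist G) p p {p}"
  unfolding geodesic_def using graph_dist_self[of p] by (auto intro!: exI[of _ "\<lambda>_. p"])

text \<open>The three neighbourhood conditions are cyclic permutations of one another, so it is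
  enough to treat the first side of every triangle.\<close>

lemma graph_delta_le:
  assumes "0 \<le> r"
    and thin: "\<And>A B C x y z p. \<lbrakk>x \<in> graph_points G; y \<in> graph_points G; z \<in> graph_points G;
        geodesic (graph_points G) (graph_dist G) x y A; geodesic (graph_points G) (graph_dist G) y z B;
        geodesic (graph_points G) (graph_dist G) z x C; p \<in> A\<rbrakk> \<Longrightarrow> \<exists>q\<in>B \<union> C. graph_dist G p q \<le> r"
  shows "graph_delta G \<le> r"
  unfolding graph_delta_def hyperbolicity_constant_def
proof (rule cSup_least)
  \<comment> \<open>A one-point triangle shows that the supremum is over a nonempty set.\<close>
  obtain v where v: "v \<in> fst G" using connected by (auto simp: connected_graph_def)
  let ?p = "edge_point v v 0"
  have p: "?p \<in> graph_points G"
    using vertex_point[OF v] .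
  have "geodesic_triangle (graph_points G) (graph_dist G) {?p} {?p} {?p}"
    unfolding geodesic_triangle_def using p geodesic_self by blast
  then show "{triangle_delta (graph_points G) (graph_dist G) A B C | A B C.
      geodesic_triangle (graph_points G) (graph_dist G) A B C} \<noteq> {}" by blast
next
  fix a assume "a \<in> {triangle_delta (graph_points G) (graph_dist G) A B C | A B C.
      geodesic_triangle (graph_points G) (graph_dist G) A B C}"
  then obtain A B C x y z where a: "a = triangle_delta (graph_points G) (graph_dist G) A B C"
    and x: "x \<in> graph_points G" and y: "y \<in> graph_points G" and z: "z \<in> graph_points G"
    and A: "geodesic (graph_points G) (graph_dist G) x y A"
    and B: "geodesic (graph_points G) (graph_dist G) y z B"
    and C: "geodesic (graph_points G) (graph_dist G) z x C"
    unfolding geodesic_triangle_def by blast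
  have "A \<subseteq> nbhd (graph_points G) (graph_dist G) r (B \<union> C)"
    using thin[OF x y z A B C] geodesic_subset[OF A] by (auto simp: nbhd_def)
  moreover have "B \<subseteq> nbhd (graph_points G) (graph_dist G) r (C \<union> A)"
    using thin[OF y z x B C A] geodesic_subset[OF B] by (auto simp: nbhd_def)
  moreover have "C \<subseteq> nbhd (graph_points G) (graph_dist G) r (A \<union> B)"
    using thin[OF z x y C A B] geodesic_subset[OF C] by (auto simp: nbhd_def)
  ultimately show "a \<le> r" unfolding a triangle_delta_def
    using \<open>0 \<le> r\<close> by (intro cInf_lower) (auto intro!: bdd_belowI[of _ 0])
qed

text \<open>One point of \<open>A\<close> far from the other sides bounds every admissible radius
  from below. The diameter bound \<open>D\<close> is an admissible radius for every triangle; this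
  makes the infimum and the supremum genuine.\<close>

lemma graph_delta_ge:
  assumes x: "x \<in> graph_points G" and y: "y \<in> graph_points G" and z: "z \<in> graph_points G"
    and A: "geodesic (graph_points G) (graph_dist G) x y A"
    and B: "geodesic (graph_points G) (graph_dist G) y z B"
    and C: "geodesic (graph_points G) (graph_dist G) z x C"
    and "p \<in> A" and far: "\<And>q. q \<in> B \<union> C \<Longrightarrow> r \<le> graph_dist G p q"
  shows "r \<le> graph_delta G"
proof -
  let ?M = "graph_points G" and ?d = "graph_dist G"
  let ?R = "\<lambda>A B C. {r. 0 \<le> r \<and> A \<subseteq> nbhd ?M ?d r (B \<union> C) \<and> B \<subseteq> nbhd ?M ?d r (C \<union> A) \<and>
      C \<subseteq> nbhd ?M ?d r (A \<union> B)}"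
  obtain D where D0: "0 \<le> D" and D: "\<And>p q. p \<in> ?M \<Longrightarrow> q \<in> ?M \<Longrightarrow> ?d p q \<le> D"
    using graph_dist_bounded by blast
  have D_in: "D \<in> ?R A B C" if tri: "geodesic_triangle ?M ?d A B C" for A B C
  proof -
    obtain x y z where "x \<in> ?M" "y \<in> ?M" "z \<in> ?M"
      and g: "geodesic ?M ?d x y A" "geodesic ?M ?d y z B" "geodesic ?M ?d z x C"
      using tri unfolding geodesic_triangle_def by blast
    then have "A \<subseteq> ?M" "B \<subseteq> ?M" "C \<subseteq> ?M" "x \<in> A" "y \<in> B" "z \<in> C"
      by (auto dest: geodesic_subset geodesic_ends graph_dist_nonneg)
    then have "S \<subseteq> nbhd ?M ?d D (T \<union> U)" if "S \<in> {A, B, C}" "T \<in> {A, B, C}" for S T U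
      using that D unfolding nbhd_def by blast
    then show ?thesis using D0 by blast
  qed
  have tri: "geodesic_triangle ?M ?d A B C"
    unfolding geodesic_triangle_def using x y z A B C by blast
  have "r \<le> triangle_delta ?M ?d A B C"
    unfolding triangle_delta_def
  proof (rule cInf_greatest)
    show "?R A B C \<noteq> {}" using D_in[OF tri] by blast
    fix e assume "e \<in> ?R A B C"
    then have "p \<in> nbhd ?M ?d e (B \<union> C)" using \<open>p \<in> A\<close> by blast
    then obtain q where "q \<in> B \<union> C" "?d p q \<le> e" by (auto simp: nbhd_def)
    with far[of q] show "r \<le> e" by linarith
  qed
  also have "\<dots> \<le> graph_delta G"
    unfolding graph_delta_def hyperbolicity_constant_def
  proof (rule cSup_upper)
    show "triangle_delta ?M ?d A B C \<in> {triangle_delta ?M ?d A B C | A B C. geodesic_triangle ?M ?d A B C}"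
      by (rule CollectI, rule exI[of _ A], rule exI[of _ B], rule exI[of _ C], rule conjI[OF HOL.refl tri])
    show "bdd_above {triangle_delta ?M ?d A B C | A B C. geodesic_triangle ?M ?d A B C}"
    proof (rule bdd_aboveI[of _ D])
      fix a assume "a \<in> {triangle_delta ?M ?d A B C | A B C. geodesic_triangle ?M ?d A B C}"
      then obtain A B C where a: "a = triangle_delta ?M ?d A B C" "geodesic_triangle ?M ?d A B C"
        by (elim CollectE exE conjE)
      show "a \<le> D" unfolding a triangle_delta_def
        by (rule cInf_lower[OF D_in[OF a(2)]]) (auto intro!: bdd_belowI[of _ 0])
    qed
  qed
  finally show ?thesis .
qed

end

section \<open>Cycles\<close>

text \<open>This form, without modular indices, lets cycles be cut, reversed, rotated and
  concatenated as lists.\<close>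

lemma is_cycle_iff_successively:
  "is_cycle G vs \<longleftrightarrow> 3 \<le> length vs \<and> distinct vs \<and>
     successively (\<lambda>u v. {u, v} \<in> snd G) vs \<and> {last vs, hd vs} \<in> snd G"
proof (cases "3 \<le> length vs")
  case True
  then obtain m where m: "length vs = Suc m" by (cases "length vs") auto
  then have "vs \<noteq> []" by auto
  then have "last vs = vs ! m" "hd vs = vs ! 0"
    using m by (simp_all add: last_conv_nth hd_conv_nth)
  moreover have "(\<forall>i<length vs. {vs ! i, vs ! (Suc i mod length vs)} \<in> snd G) \<longleftrightarrow>
      (\<forall>i<m. {vs ! i, vs ! Suc i} \<in> snd G) \<and> {vs ! m, vs ! 0} \<in> snd G"
  proof -
    have "Suc i mod Suc m = Suc i" if "i < m" for i using that by (intro mod_less) simp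
    then show ?thesis unfolding m by (auto simp: less_Suc_eq all_conj_distrib)
  qed
  ultimately show ?thesis unfolding is_cycle_def successively_conv_nth using m by auto
qed (simp add: is_cycle_def)

lemma cycle_edge:
  assumes "is_cycle G vs"
  shows "{vs ! (k mod length vs), vs ! (Suc k mod length vs)} \<in> snd G"
proof -
  have "k mod length vs < length vs" using assms by (intro mod_less_divisor) (auto simp: is_cycle_def)
  then show ?thesis using assms unfolding is_cycle_def by (metis mod_Suc_eq)
qed

text \<open>Equal vertices have equal residues, so the length divides \<open>j - i\<close>, which is
  smaller than the length. Indices stay unreduced, within a window of one period.\<close>

lemma cycle_vertex_inj:
  assumes "is_cycle G vs" "i \<le> j" "j < i + length vs"
    and eq: "vs ! (i mod length vs) = vs ! (j mod length vs)"
  shows "i = j"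
proof -
  have L: "0 < length vs" using assms(1) by (auto simp: is_cycle_def)
  have "i mod length vs = j mod length vs"
    using assms(1) eq L by (simp add: is_cycle_def nth_eq_iff_index_eq)
  then have "length vs dvd j - i" using assms(2) by (metis mod_eq_dvd_iff_nat)
  moreover have "j - i < length vs" using assms(2,3) by linarith
  ultimately have "j - i = 0" using nat_dvd_not_less by blast
  then show ?thesis using assms(2) by simp
qed

text \<open>The arc-length parametrization, winding round the cycle for all \<open>t\<close> from 0
  on, so that arcs through the starting vertex need no case distinction.\<close>

definition cycle_point :: "'a list \<Rightarrow> real \<Rightarrow> ('a \<Rightarrow> real)" where
  "cycle_point vs t = edge_point (vs ! (nat \<lfloor>t\<rfloor> mod length vs)) (vs ! (Suc (nat \<lfloor>t\<rfloor>) mod length vs))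
     (t - real (nat \<lfloor>t\<rfloor>))"

text \<open>The closed interval matters: at its right end the floor has already jumped to the next
  edge, but both formulas then describe the common vertex.\<close>

lemma cycle_point_eq:
  assumes "real k \<le> t" "t \<le> real k + 1"
  shows "cycle_point vs t = edge_point (vs ! (k mod length vs)) (vs ! (Suc k mod length vs)) (t - real k)"
proof (cases "t = real k + 1")
  case True
  then have "nat \<lfloor>t\<rfloor> = Suc k" by (simp add: nat_add_distrib)
  then have "cycle_point vs t = edge_point (vs ! (Suc k mod length vs)) (vs ! (Suc (Suc k) mod length vs)) 0"
    using True by (simp add: cycle_point_def)
  then show ?thesis using True by (simp add: edge_point_1 edge_point_0[of _ "vs ! (Suc (Suc k) mod length vs)"])
next
  case False
  then have "\<lfloor>t\<rfloor> = int k" using assms by linarith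
  then have "nat \<lfloor>t\<rfloor> = k" by simp
  then show ?thesis by (simp add: cycle_point_def)
qed

lemma nat_floor_bounds: "0 \<le> (t::real) \<Longrightarrow> real (nat \<lfloor>t\<rfloor>) \<le> t \<and> t < real (nat \<lfloor>t\<rfloor>) + 1"
  by linarith

lemma path_length_cycle_edge:
  assumes "is_cycle G vs" "real k \<le> s" "s \<le> t" "t \<le> real k + 1"
  shows "path_length G (cycle_point vs s) (cycle_point vs t) (t - s)"
proof -
  have "path_length G (cycle_point vs s) (cycle_point vs t) \<bar>(s - real k) - (t - real k)\<bar>"
    using assms cycle_edge[OF assms(1), of k]
    by (simp only: cycle_point_eq[of k s] cycle_point_eq[of k t]) (intro path_length_edge, auto)
  then show ?thesis using assms by simp
qed

lemma path_length_cycle: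
  assumes cyc: "is_cycle G vs" and "0 \<le> s" "s \<le> t"
  shows "path_length G (cycle_point vs s) (cycle_point vs t) (t - s)"
proof -
  \<comment> \<open>Induction on the number \<open>n\<close> of further edges after the one that
    contains \<open>s\<close>.\<close>
  have "path_length G (cycle_point vs s) (cycle_point vs t) (t - s)"
    if "s \<le> t" "t \<le> real (nat \<lfloor>s\<rfloor>) + 1 + real n" for n
    using that
  proof (induction n arbitrary: t)
    case 0
    then show ?case using path_length_cycle_edge[OF cyc, of "nat \<lfloor>s\<rfloor>" s t] nat_floor_bounds[OF \<open>0 \<le> s\<close>] by simp
  next
    case (Suc n)
    let ?m = "nat \<lfloor>s\<rfloor> + 1 + n"
    show ?case
    proof (cases "t \<le> real ?m")
      case True
      then show ?thesis using Suc by simp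
    next
      case False
      have "path_length G (cycle_point vs s) (cycle_point vs (real ?m)) (real ?m - s)"
        using nat_floor_bounds[OF \<open>0 \<le> s\<close>] by (intro Suc.IH) (simp_all only: of_nat_add of_nat_1, linarith+)
      moreover have "path_length G (cycle_point vs (real ?m)) (cycle_point vs t) (t - real ?m)"
        using Suc.prems False by (intro path_length_cycle_edge[OF cyc, of ?m]) auto
      ultimately show ?thesis using path_length_trans by fastforce
    qed
  qed
  from this[of "nat \<lceil>t\<rceil>"] assms(3) show ?thesis by linarith
qed

lemma cycle_point_periodic:
  assumes "0 \<le> t"
  shows "cycle_point vs (t + real (length vs)) = cycle_point vs t"
proof -
  have "nat \<lfloor>t + real (length vs)\<rfloor> = nat \<lfloor>t\<rfloor> + length vs"
    using assms by (simp add: nat_add_distrib)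
  then show ?thesis
    unfolding cycle_point_def by (simp flip: add_Suc)
qed

lemma graph_dist_cycle_le:
  assumes "is_cycle G vs" "0 \<le> s" "s \<le> t"
  shows "graph_dist G (cycle_point vs s) (cycle_point vs t) \<le> t - s"
  using assms by (intro graph_dist_le path_length_cycle)

lemma graph_dist_cycle_half:
  assumes "is_cycle G vs" "0 \<le> s" "s \<le> real (length vs)" "0 \<le> t" "t \<le> real (length vs)"
  shows "graph_dist G (cycle_point vs s) (cycle_point vs t) \<le> real (length vs) / 2"
proof -
  \<comment> \<open>One of the two arcs is at most half the cycle; by periodicity the complementary
    arc runs from \<open>t\<close> to \<open>s + length vs\<close>.\<close>
  have *: "graph_dist G (cycle_point vs s) (cycle_point vs t) \<le> real (length vs) / 2"
    if "0 \<le> s" "s \<le> t" "t \<le> real (length vs)" for s t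
    using graph_dist_cycle_le[OF assms(1) that(1,2)]
      graph_dist_cycle_le[OF assms(1), of t "s + real (length vs)"] that cycle_point_periodic[of s vs]
      graph_dist_commute[of G "cycle_point vs s" "cycle_point vs t"]
    by (simp add: field_simps)
  show ?thesis
    using *[of s t] *[of t s] assms graph_dist_commute[of G "cycle_point vs s" "cycle_point vs t"]
    by (cases "s \<le> t") auto
qed

lemma cycle_segment:
  assumes "p \<in> segment (vs ! i) (vs ! (Suc i mod length vs))" "i < length vs"
  obtains t where "0 \<le> t" "t \<le> real (length vs)" "p = cycle_point vs t"
proof -
  obtain t where t: "0 \<le> t" "t \<le> 1" "p = edge_point (vs ! i) (vs ! (Suc i mod length vs)) t"
    using assms(1) by (rule segmentE)
  then have "p = cycle_point vs (real i + t)" using assms(2) by (subst cycle_point_eq[of i]) auto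
  with t assms(2) show ?thesis by (intro that[of "real i + t"]) auto
qed

text \<open>Drop the common initial part. Where the paths diverge, follow the first until it first
  meets the second, at \<open>w\<close>, and return along the second; stopping at the first meeting
  keeps the vertices distinct.\<close>

lemma two_paths_cycle:
  assumes "distinct (u # P)" "distinct (u # Q)"
    and "successively (\<lambda>u v. {u, v} \<in> snd G) (u # P)" "successively (\<lambda>u v. {u, v} \<in> snd G) (u # Q)"
    and "last (u # P) = last (u # Q)" "P \<noteq> Q"
  shows "\<exists>vs. is_cycle G vs \<and> length vs \<le> length P + length Q"
  using assms
proof (induction P arbitrary: u Q)
  case Nil
  then have "last Q = u" "Q \<noteq> []" by auto
  then show ?case using Nil last_in_set by fastforce
next
  case (Cons p P)
  show ?case
  proof (cases Q)
    case Nil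
    then have "last (p # P) = u" using Cons.prems(5) by simp
    then show ?thesis using Cons.prems(1) last_in_set[of "p # P"] by auto
  next
    case (Cons q Q')
    note Q = this
    show ?thesis
    proof (cases "p = q")
      case True
      then have "\<exists>vs. is_cycle G vs \<and> length vs \<le> length P + length Q'"
        using Cons.prems Q by (intro Cons.IH[of p Q']) auto
      then show ?thesis using Q by auto
    next
      case False
      have "last (p # P) \<in> set (p # P) \<inter> set Q"
        using Cons.prems(5) Q last_in_set[of "p # P"] last_in_set[of Q] by simp
      then have "\<exists>w\<in>set (p # P). w \<in> set Q" by blast
      then obtain P1 w P2 where P: "p # P = P1 @ w # P2" "w \<in> set Q" "\<forall>x\<in>set P1. x \<notin> set Q"
        by (rule split_list_first_propE)
      then obtain Q1 Q2 where Q12: "Q = Q1 @ w # Q2" by (meson split_list)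
      let ?vs = "u # P1 @ w # rev Q1"
      \<comment> \<open>The paths leave \<open>u\<close> through different vertices, so
        \<open>w\<close> cannot be next to \<open>u\<close> on both; hence the cycle has at least
        three vertices.\<close>
      have "P1 \<noteq> [] \<or> Q1 \<noteq> []" using P(1) Q12 Q False by auto
      then have "3 \<le> length ?vs" by (cases P1; cases Q1) auto
      moreover have "distinct ?vs" using Cons.prems(1,2) P Q12 by auto
      moreover have "successively (\<lambda>u v. {u, v} \<in> snd G) ?vs"
      proof -
        have "successively (\<lambda>u v. {u, v} \<in> snd G) ((u # P1) @ [w])"
          using Cons.prems(3) successively_append_iff[of _ "(u # P1) @ [w]" P2] unfolding P(1) by simp
        moreover have "successively (\<lambda>u v. {u, v} \<in> snd G) (Q1 @ [w])"
          using Cons.prems(4) successively_append_iff[of _ "(u # Q1) @ [w]" Q2] unfolding Q12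
          by (auto simp: successively_Cons)
        then have "successively (\<lambda>u v. {v, u} \<in> snd G) (rev (Q1 @ [w]))"
          unfolding successively_rev .
        then have "successively (\<lambda>u v. {u, v} \<in> snd G) (w # rev Q1)"
          by (simp add: insert_commute)
        ultimately show ?thesis
          using successively_append_iff[of "\<lambda>u v. {u, v} \<in> snd G" "u # P1" "w # rev Q1"]
            successively_append_iff[of "\<lambda>u v. {u, v} \<in> snd G" "u # P1" "[w]"] by simp
      qed
      moreover have "{last ?vs, hd ?vs} \<in> snd G"
        using Cons.prems(4) unfolding Q12
        by (cases Q1) (auto simp: successively_Cons insert_commute last_rev)
      moreover have "length ?vs \<le> length (p # P) + length Q" unfolding P(1) Q12 by simp
      ultimately show ?thesis unfolding is_cycle_iff_successively by blast
    qed
  qed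
qed

lemma walk_imp_path:
  assumes "(u, v) \<in> {(x, y). {x, y} \<in> snd G} ^^ k"
  shows "\<exists>P. distinct (u # P) \<and> successively (\<lambda>u v. {u, v} \<in> snd G) (u # P) \<and>
           last (u # P) = v \<and> length P \<le> k"
  using assms
proof (induction k arbitrary: u)
  case 0
  then show ?case by (intro exI[of _ "[]"]) auto
next
  case (Suc k)
  from Suc.prems obtain w where w: "{u, w} \<in> snd G" "(w, v) \<in> {(x, y). {x, y} \<in> snd G} ^^ k"
    by (elim relpow_Suc_E2) auto
  from Suc.IH[OF w(2)] obtain P where P: "distinct (w # P)" "successively (\<lambda>u v. {u, v} \<in> snd G) (w # P)"
      "last (w # P) = v" "length P \<le> k" by blast
  show ?case
  proof (cases "u \<in> set (w # P)")
    case True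
    \<comment> \<open>The path returns to \<open>u\<close>: cut out the loop and keep what follows
      \<open>u\<close>.\<close>
    then obtain S C where SC: "w # P = S @ u # C" by (meson split_list)
    have "length (w # P) = length S + Suc (length C)" unfolding SC by simp
    then have "length C \<le> Suc k" using P(4) by simp
    then show ?thesis using P unfolding SC
      by (intro exI[of _ C]) (auto simp: successively_append_iff)
  next
    case False
    then show ?thesis using P w by (intro exI[of _ "w # P"]) auto
  qed
qed

text \<open>A walk shorter than both arcs contains a path which differs from the arc from
  \<open>i\<close> to \<open>j\<close>. Together they contain a cycle of length at most
  \<open>k + (j - i)\<close>, less than \<open>length vs\<close>.\<close>

lemma shortest_cycle_walk:
  assumes cyc: "is_cycle G vs" and min: "\<And>ws. is_cycle G ws \<Longrightarrow> length vs \<le> length ws"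
    and ij: "i \<le> j" "j \<le> i + length vs"
    and walk: "(vs ! (i mod length vs), vs ! (j mod length vs)) \<in> {(x, y). {x, y} \<in> snd G} ^^ k"
  shows "min (j - i) (length vs - (j - i)) \<le> k"
proof (rule ccontr)
  assume "\<not> ?thesis"
  then have k: "k < j - i" "k < length vs - (j - i)" by auto
  let ?v = "\<lambda>k. vs ! (k mod length vs)"
  obtain P where P: "distinct (?v i # P)" "successively (\<lambda>u v. {u, v} \<in> snd G) (?v i # P)"
      "last (?v i # P) = ?v j" "length P \<le> k" using walk_imp_path[OF walk] by blast
  define Q where "Q = map ?v [Suc i..<Suc j]"
  have Q: "?v i # Q = map ?v [i..<Suc j]" 
    unfolding Q_def upt_conv_Cons[OF le_imp_less_Suc[OF ij(1)]] by (simp only: list.map)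
  have lt: "j < i + length vs" using k ij by arith
  have "x = y" if "x \<in> {i..j}" "y \<in> {i..j}" "?v x = ?v y" for x y
  proof (cases "x \<le> y")
    case True
    moreover have "y < x + length vs" using that lt by simp
    ultimately show ?thesis using cycle_vertex_inj[OF cyc] that(3) by blast
  next
    case False
    then have "y \<le> x" "x < y + length vs" using that lt by simp_all
    then show ?thesis using cycle_vertex_inj[OF cyc] that(3) by metis
  qed
  then have "distinct (?v i # Q)" unfolding Q distinct_map by (auto intro!: inj_onI simp del: upt_Suc)
  moreover have "successively (\<lambda>u v. {u, v} \<in> snd G) (?v i # Q)"
    unfolding Q successively_conv_nth using cycle_edge[OF cyc] by (simp del: upt_Suc)
  moreover have "last (?v i # Q) = last (?v i # P)" unfolding P(3) Q using ij by simp
  moreover have "P \<noteq> Q" using P(4) k by (auto simp: Q_def)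
  ultimately obtain ws where "is_cycle G ws" "length ws \<le> length P + length Q"
    using two_paths_cycle[OF P(1) _ P(2)] by metis
  moreover have "length Q = j - i" by (simp add: Q_def del: upt_Suc)
  ultimately show False using min[of ws] k P(4) by linarith
qed

section \<open>Shortest cycles are isometrically embedded\<close>

context finite_connected_graph
begin

lemma cycle_point_in:
  assumes "is_cycle G vs" "0 \<le> t"
  shows "cycle_point vs t \<in> graph_points G"
  unfolding cycle_point_def using nat_floor_bounds[OF assms(2)]
  by (intro edge_point_in cycle_edge[OF assms(1)]) linarith+

lemma walk_dist_self: "walk_dist u u = 0"
  using walk_dist_le[of u u 0] by simp

lemma walk_dist_ge_1: "u \<in> fst G \<Longrightarrow> v \<in> fst G \<Longrightarrow> u \<noteq> v \<Longrightarrow> 1 \<le> walk_dist u v"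
  using walk_dist[of u v] by (cases "walk_dist u v") auto

lemma walk_dist_edge:
  assumes "a \<in> fst G" "{u, v} \<in> snd G"
  shows "\<bar>real (walk_dist a u) - real (walk_dist a v)\<bar> \<le> 1"
proof -
  have *: "walk_dist a v \<le> Suc (walk_dist a u)" if "{u, v} \<in> snd G" for u v
    using walk_dist[OF assms(1), of u] edgeD[OF that] that by (intro walk_dist_le relpow_Suc_I) auto
  show ?thesis using *[OF assms(2)] *[of v u] assms(2) by (simp add: insert_commute)
qed

text \<open>The Lipschitz function used here is the distance from a point of the edge \<open>{a, b}\<close>, written
  in barycentric coordinates: it is V-shaped on \<open>{a, b}\<close>, and on any other edge it is the
  smaller of the two linear functions that grow away from the ends.\<close>

lemma graph_dist_edges_ge:
  assumes ab: "{a, b} \<in> snd G" and \<theta>: "0 \<le> \<theta>" "\<theta> \<le> 1"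
    and cd: "{c, d} \<in> snd G" and \<phi>: "0 \<le> \<phi>" "\<phi> \<le> 1" and ne: "{c, d} \<noteq> {a, b}"
  defines "f \<equiv> \<lambda>v. min (\<theta> + real (walk_dist a v)) (1 - \<theta> + real (walk_dist b v))"
  shows "min (f c + \<phi>) (f d + (1 - \<phi>)) \<le> graph_dist G (edge_point a b \<theta>) (edge_point c d \<phi>)"
proof -
  \<comment> \<open>For points of the graph, \<open>q a + q b = 1\<close> detects the closed edge
    between \<open>a\<close> and \<open>b\<close>. Elsewhere \<open>w\<close> ranges over the ends
    of the edge carrying \<open>q\<close>, and \<open>1 - q w\<close> is the distance along that
    edge to \<open>w\<close>.\<close>
  define F where "F = (\<lambda>q. if q a + q b = 1 then \<bar>q b - \<theta>\<bar>
      else Min ((\<lambda>w. f w + 1 - q w) ` {w \<in> fst G. q w \<noteq> 0}))"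
  note ab' = edgeD[OF ab]
  have f_lip: "\<bar>f u - f v\<bar> \<le> 1" if "{u, v} \<in> snd G" for u v
    using walk_dist_edge[OF ab'(1) that] walk_dist_edge[OF ab'(2) that] unfolding f_def by linarith
  have fa: "f a = \<theta>" and fb: "f b = 1 - \<theta>"
    unfolding f_def using walk_dist_self[of a] walk_dist_self[of b] \<theta>
      walk_dist_ge_1[OF ab'] walk_dist_ge_1[OF ab'(2,1)] ab'(3) by auto
  have vertex: "F (edge_point u u 0) = f u" if "u \<in> fst G" for u
  proof (cases "u = a \<or> u = b")
    case True
    then show ?thesis using ab'(3) \<theta> fa fb by (auto simp: F_def edge_point_def)
  next
    case False
    then have "{w \<in> fst G. edge_point u u 0 w \<noteq> 0} = {u}"
      using that by (auto simp: edge_point_def indicator_def)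
    then show ?thesis using False by (auto simp: F_def edge_point_def indicator_def)
  qed
  have same: "F (edge_point a b t) = \<bar>t - \<theta>\<bar>" for t
    using ab'(3) by (simp add: F_def edge_point_def)
  have other: "F (edge_point u v t) = min (f u + t) (f v + (1 - t))"
    if uv: "{u, v} \<in> snd G" and ne: "{u, v} \<noteq> {a, b}" and t: "0 \<le> t" "t \<le> 1" for u v t
  proof -
    note uv' = edgeD[OF uv]
    \<comment> \<open>At an end of the edge only one vertex has a nonzero coordinate;
      \<open>f_lip\<close> shows that the minimum on the right is attained there.\<close>
    consider "t = 0" | "t = 1" | "0 < t" "t < 1" using t by linarith
    then show ?thesis
    proof cases
      case 1
      then show ?thesis using vertex[OF uv'(1)] f_lip[OF uv] edge_point_0[of u v] by auto
    next
      case 2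
      then show ?thesis using vertex[OF uv'(2)] f_lip[OF uv] edge_point_1[of u v] by auto
    next
      case 3
      have "{w \<in> fst G. edge_point u v t w \<noteq> 0} = {u, v}"
        using uv' 3 by (auto simp: edge_point_def indicator_def)
      moreover have "edge_point u v t a + edge_point u v t b \<noteq> 1"
        using uv'(3) ab'(3) ne 3 by (auto simp: edge_point_def indicator_def doubleton_eq_iff)
      ultimately show ?thesis using uv' by (simp add: F_def edge_point_def indicator_def algebra_simps)
    qed
  qed
  \<comment> \<open>Since \<open>F\<close> vanishes at the first point, the Lipschitz bound is the
    value of \<open>F\<close> at the second.\<close>
  have "\<bar>F (edge_point a b \<theta>) - F (edge_point c d \<phi>)\<bar> \<le> graph_dist G (edge_point a b \<theta>) (edge_point c d \<phi>)"
  proof (rule graph_dist_lipschitz)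
    fix u v and s t :: real assume uv: "{u, v} \<in> snd G" and st: "s \<in> {0..1}" "t \<in> {0..1}"
    show "\<bar>F (edge_point u v s) - F (edge_point u v t)\<bar> \<le> \<bar>s - t\<bar>"
    proof (cases "{u, v} = {a, b}")
      case True
      then consider "u = a" "v = b" | "u = b" "v = a" by (auto simp: doubleton_eq_iff)
      then show ?thesis
        by cases (auto simp: same edge_point_swap[of b a] abs_if)
    next
      case False
      then show ?thesis using other[OF uv] st by auto
    qed
  qed (use ab cd \<theta> \<phi> edge_point_in in auto)
  then show ?thesis using same[of \<theta>] other[OF cd ne \<phi>] by linarith
qed

text \<open>The points lie on two edges whose end vertices are at least as far apart in
  \<open>G\<close> as along the cycle. So each way of leaving the first edge and entering the second
  costs at least half the cycle.\<close>

lemma antipodal_dist: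
  assumes cyc: "is_cycle G vs" and min: "\<And>ws. is_cycle G ws \<Longrightarrow> length vs \<le> length ws"
    and L5: "5 \<le> length vs" and s: "0 \<le> s"
  shows "real (length vs) / 2 \<le> graph_dist G (cycle_point vs s) (cycle_point vs (s + real (length vs) / 2))"
proof -
  let ?L = "length vs"
  let ?v = "\<lambda>k. vs ! (k mod ?L)"
  define t where "t = s + real ?L / 2"
  define i where "i = nat \<lfloor>s\<rfloor>"
  define j where "j = nat \<lfloor>t\<rfloor>"
  have t: "0 \<le> t" using s by (simp add: t_def)
  have i: "real i \<le> s" "s < real i + 1" using nat_floor_bounds[OF s] by (auto simp: i_def)
  have j: "real j \<le> t" "t < real j + 1" using nat_floor_bounds[OF t] by (auto simp: j_def)
  \<comment> \<open>Length at least 5 makes the two edges disjoint, so that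
    \<open>graph_dist_edges_ge\<close> applies.\<close>
  have "real i + 1 < real j" "real j + 1 < real i + real ?L"
    using i j L5 unfolding t_def by (auto simp: field_simps)
  then have ij: "Suc i < j" "Suc j < i + ?L" by linarith+
  have wd: "min (real l - real k) (real ?L - (real l - real k)) \<le> real (walk_dist (?v k) (?v l))"
    if "k \<le> l" "l \<le> k + ?L" for k l
  proof -
    have "min (l - k) (?L - (l - k)) \<le> walk_dist (?v k) (?v l)"
      using cyc min that
      by (rule shortest_cycle_walk) (auto intro!: walk_dist edgeD(1)[OF cycle_edge[OF cyc]])
    then show ?thesis using that by (auto simp: min_def of_nat_diff split: if_splits)
  qed
  have ne: "{?v j, ?v (Suc j)} \<noteq> {?v i, ?v (Suc i)}"
    using cycle_vertex_inj[OF cyc, of i j] cycle_vertex_inj[OF cyc, of i "Suc j"] ij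
    by (auto simp: doubleton_eq_iff)
  let ?f = "\<lambda>v. min ((s - real i) + real (walk_dist (?v i) v)) (1 - (s - real i) + real (walk_dist (?v (Suc i)) v))"
  have upper: "min (?f (?v j) + (t - real j)) (?f (?v (Suc j)) + (1 - (t - real j)))
      \<le> graph_dist G (edge_point (?v i) (?v (Suc i)) (s - real i)) (edge_point (?v j) (?v (Suc j)) (t - real j))"
    using i j ne by (intro graph_dist_edges_ge cycle_edge[OF cyc]) auto
  have lower: "real ?L / 2 \<le> min (?f (?v j) + (t - real j)) (?f (?v (Suc j)) + (1 - (t - real j)))"
  proof -
    \<comment> \<open>One inequality for each choice of an end of the first edge and an end of the
      second.\<close>
    have "real ?L / 2 \<le> (s - real i) + real (walk_dist (?v i) (?v j)) + (t - real j)"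
      using wd[of i j] ij i j t_def by linarith
    moreover have "real ?L / 2 \<le> (s - real i) + real (walk_dist (?v i) (?v (Suc j))) + (1 - (t - real j))"
      using wd[of i "Suc j"] ij i j t_def by linarith
    moreover have "real ?L / 2 \<le> 1 - (s - real i) + real (walk_dist (?v (Suc i)) (?v j)) + (t - real j)"
      using wd[of "Suc i" j] ij i j t_def by linarith
    moreover have "real ?L / 2 \<le> 1 - (s - real i) + real (walk_dist (?v (Suc i)) (?v (Suc j))) + (1 - (t - real j))"
      using wd[of "Suc i" "Suc j"] ij i j t_def by linarith
    ultimately show ?thesis by linarith
  qed
  have eqs: "cycle_point vs s = edge_point (?v i) (?v (Suc i)) (s - real i)"
      "cycle_point vs t = edge_point (?v j) (?v (Suc j)) (t - real j)"
    using i j by (intro cycle_point_eq; linarith)+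
  show ?thesis unfolding t_def[symmetric] eqs by (rule order_trans[OF lower upper])
qed

text \<open>No distance exceeds the arc length. If some subarc could be shortened, the triangle
  inequality would bring the antipodal ends closer than half the cycle.\<close>

lemma half_cycle_geodesic:
  assumes cyc: "is_cycle G vs" and min: "\<And>ws. is_cycle G ws \<Longrightarrow> length vs \<le> length ws"
    and L5: "5 \<le> length vs" and r: "0 \<le> r"
  shows "geodesic (graph_points G) (graph_dist G) (cycle_point vs r) (cycle_point vs (r + real (length vs) / 2))
           (cycle_point vs ` {r..r + real (length vs) / 2})"
proof -
  let ?d = "\<lambda>s t. graph_dist G (cycle_point vs s) (cycle_point vs t)" and ?h = "real (length vs) / 2"
  have le: "?d s t \<le> t - s" if "0 \<le> s" "s \<le> t" for s t
    using graph_dist_cycle_le[OF cyc that] .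
  have anti: "?h \<le> ?d r (r + ?h)" using antipodal_dist[OF cyc min L5 r] .
  have eq: "?d s t = t - s" if "r \<le> s" "s \<le> t" "t \<le> r + ?h" for s t
  proof (rule antisym)
    have "?d r (r + ?h) \<le> ?d r s + ?d s (r + ?h)" "?d s (r + ?h) \<le> ?d s t + ?d t (r + ?h)"
      using that r by (auto intro!: graph_dist_triangle cycle_point_in[OF cyc])
    then show "t - s \<le> ?d s t" using anti le[of r s] le[of t "r + ?h"] that r by linarith
  qed (use le that r in auto)
  have D: "?d r (r + ?h) = ?h" using eq[of r "r + ?h"] by simp
  have iso: "?d (r + s) (r + t) = \<bar>s - t\<bar>" if "s \<in> {0..?h}" "t \<in> {0..?h}" for s t
    using eq[of "r + s" "r + t"] eq[of "r + t" "r + s"] that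
      graph_dist_commute[of G "cycle_point vs (r + s)" "cycle_point vs (r + t)"]
    by (cases "s \<le> t") auto
  have "(\<lambda>s. cycle_point vs (r + s)) ` {0..?h} = cycle_point vs ` ((+) r ` {0..?h})"
    by (simp only: image_image)
  also have "(+) r ` {0..?h} = {r..r + ?h}" by (simp add: add.commute)
  finally have im: "(\<lambda>s. cycle_point vs (r + s)) ` {0..?h} = cycle_point vs ` {r..r + ?h}" .
  show ?thesis unfolding geodesic_def D
  proof (intro conjI exI[of _ "\<lambda>s. cycle_point vs (r + s)"] ballI)
    show "cycle_point vs ` {r..r + ?h} \<subseteq> graph_points G"
      using r cycle_point_in[OF cyc] by auto
  qed (use im iso in auto)
qed

lemma graph_delta_ge_shortest_cycle:
  assumes cyc: "is_cycle G vs" and min: "\<And>ws. is_cycle G ws \<Longrightarrow> length vs \<le> length ws"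
    and L5: "5 \<le> length vs"
  shows "real (length vs) / 4 \<le> graph_delta G"
proof -
  let ?\<sigma> = "cycle_point vs" and ?L = "real (length vs)"
  have mem: "?\<sigma> t \<in> graph_points G" if "0 \<le> t" for t using cycle_point_in[OF cyc that] .
  have per: "?\<sigma> ?L = ?\<sigma> 0" using cycle_point_periodic[of 0 vs] by simp
  show ?thesis
  proof (rule graph_delta_ge)
    show "geodesic (graph_points G) (graph_dist G) (?\<sigma> 0) (?\<sigma> (?L / 2)) (?\<sigma> ` {0..?L / 2})"
      using half_cycle_geodesic[OF cyc min L5, of 0] by simp
    show "geodesic (graph_points G) (graph_dist G) (?\<sigma> (?L / 2)) (?\<sigma> 0) (?\<sigma> ` {?L / 2..?L})"
      using half_cycle_geodesic[OF cyc min L5, of "?L / 2"] per by simp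
    show "geodesic (graph_points G) (graph_dist G) (?\<sigma> 0) (?\<sigma> 0) {?\<sigma> 0}"
      by (rule geodesic_self[OF mem]) simp
    show "?\<sigma> (?L / 4) \<in> ?\<sigma> ` {0..?L / 2}" by auto
    fix q assume "q \<in> ?\<sigma> ` {?L / 2..?L} \<union> {?\<sigma> 0}"
    moreover have "?\<sigma> 0 \<in> ?\<sigma> ` {?L / 2..?L}" using per by (intro image_eqI[of _ _ ?L]) auto
    ultimately obtain t where t: "?L / 2 \<le> t" "t \<le> ?L" "q = ?\<sigma> t" by auto
    then have t0: "0 \<le> t" using L5 by linarith
    \<comment> \<open>The antipode of the midpoint is the middle of the other half, so every
      \<open>q\<close> there is within \<open>?L / 4\<close> of it and at least
      \<open>?L / 2 - ?L / 4\<close> from the midpoint.\<close>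
    have "graph_dist G (?\<sigma> (?L / 4)) (?\<sigma> (?L / 4 + ?L / 2))
        \<le> graph_dist G (?\<sigma> (?L / 4)) q + graph_dist G q (?\<sigma> (?L / 4 + ?L / 2))"
      unfolding t(3) using t0 by (intro graph_dist_triangle mem) auto
    moreover have "?L / 2 \<le> graph_dist G (?\<sigma> (?L / 4)) (?\<sigma> (?L / 4 + ?L / 2))"
      by (rule antipodal_dist[OF cyc min L5]) auto
    moreover have "graph_dist G q (?\<sigma> (?L / 4 + ?L / 2)) \<le> ?L / 4"
      using graph_dist_cycle_le[OF cyc, of t "?L / 4 + ?L / 2"]
        graph_dist_cycle_le[OF cyc, of "?L / 4 + ?L / 2" t] t t0
        graph_dist_commute[of G q "?\<sigma> (?L / 4 + ?L / 2)"]
      by (cases "t \<le> ?L / 4 + ?L / 2") (auto simp: field_simps)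
    ultimately show "?L / 4 \<le> graph_dist G (?\<sigma> (?L / 4)) q" by linarith
  qed (use mem in auto)
qed

end

lemma girth_attained:
  assumes "girth G = enat g"
  obtains vs where "is_cycle G vs" "length vs = g" "\<And>ws. is_cycle G ws \<Longrightarrow> g \<le> length ws"
proof -
  let ?A = "(\<lambda>vs. enat (length vs)) ` {vs. is_cycle G vs}"
  have A: "Inf ?A = enat g" using assms by (simp add: girth_def)
  \<comment> \<open>The infimum of the empty set is infinite; a nonempty set of extended naturals
    contains its infimum.\<close>
  then have "?A \<noteq> {}" by (metis Inf_enat_def enat.distinct(1) infinity_ne_i0)
  then have "enat g \<in> ?A" using A unfolding Inf_enat_def by (metis LeastI ex_in_conv)
  then obtain vs where "is_cycle G vs" "length vs = g" by auto
  moreover have "g \<le> length ws" if "is_cycle G ws" for ws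
    using Inf_lower[of "enat (length ws)" ?A] A that by simp
  ultimately show ?thesis by (rule that)
qed

lemma cycle_rotate_to:
  assumes "is_cycle G vs" "x \<in> set vs"
  obtains ws where "is_cycle G (x # ws)" "set (x # ws) = set vs" "length (x # ws) = length vs"
proof -
  obtain A B where vs: "vs = A @ x # B" using assms(2) by (meson split_list)
  show ?thesis
  proof (rule that[of "B @ A"])
    show "is_cycle G (x # B @ A)"
    proof (cases "A = []")
      case True
      then show ?thesis using assms(1) vs by simp
    next
      case False
      then show ?thesis using assms(1) successively_append_iff[of "\<lambda>u v. {u, v} \<in> snd G" "x # B" A]
        unfolding vs is_cycle_iff_successively by (auto simp: successively_append_iff)
    qed
  qed (auto simp: vs)
qed

text \<open>With \<open>x\<close> rotated to the front, these are the second and the last vertex. It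
  serves to exclude vertices of degree one from cycles.\<close>

lemma cycle_neighbours:
  assumes "is_cycle G vs" "x \<in> set vs"
  obtains y z where "y \<in> set vs" "z \<in> set vs" "y \<noteq> z" "{x, y} \<in> snd G" "{x, z} \<in> snd G"
proof -
  obtain ws where ws: "is_cycle G (x # ws)" "set (x # ws) = set vs"
    using cycle_rotate_to[OF assms] by metis
  then obtain y z r where r: "ws = y # z # r"
    by (cases ws rule: remdups_adj.cases) (auto simp: is_cycle_def)
  let ?z = "last (z # r)"
  have "?z \<in> set (z # r)" by (rule last_in_set) simp
  then have "?z \<in> set vs" "y \<noteq> ?z" using ws unfolding r by (auto simp: is_cycle_def)
  moreover have "{x, y} \<in> snd G" "{x, ?z} \<in> snd G" "y \<in> set vs"
    using ws unfolding r is_cycle_iff_successively by (auto simp: insert_commute)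
  ultimately show ?thesis using that by blast
qed

section \<open>Fans of cycles\<close>

text \<open>The rim \<open>1, \<dots>, c - 1\<close> is a path, the hub \<open>0\<close> is joined to the rim vertices in \<open>S\<close>, and the
  vertices from \<open>c\<close> on are leaves at the hub. Consecutive elements of \<open>S\<close> bound a cycle through
  the hub, of length \<open>g\<close>, \<open>g + 1\<close> or \<open>g + 2\<close>.\<close>

locale fan =
  fixes g c n :: nat and S :: "nat set"
  assumes g: "5 \<le> g" and cn: "c \<le> n" and S: "S \<subseteq> {1..<c}" "1 \<in> S" "c - 1 \<in> S"
    and gap: "\<And>s s'. s \<in> S \<Longrightarrow> s' \<in> S \<Longrightarrow> s < s' \<Longrightarrow> s + g \<le> s' + 2"
    and cover: "\<And>k. 1 \<le> k \<Longrightarrow> Suc k < c \<Longrightarrow> \<exists>v\<in>S. \<exists>v'\<in>S. v \<le> k \<and> k < v' \<and> v' \<le> v + g"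
    and exact: "\<exists>s\<in>S. \<exists>s'\<in>S. s' + 2 = s + g"
begin

text \<open>Pendant edges count as spokes, so that all edges at the hub are treated alike.\<close>

definition spokes :: "nat set" where
  "spokes = S \<union> {c..<n}"

definition graph :: "nat graph" where
  "graph = ({..<n}, {{0, j} | j. j \<in> spokes} \<union> {{k, Suc k} | k. 1 \<le> k \<and> Suc k < c})"

lemma c_ge: "g \<le> c"
proof -
  obtain s s' where "s \<in> S" "s' \<in> S" "s' + 2 = s + g" using exact by blast
  then have "1 \<le> s" "s' < c" "s' + 2 = s + g" using S(1) by auto
  then show ?thesis by linarith
qed

lemma spokesD: "j \<in> spokes \<Longrightarrow> 0 < j \<and> j < n"
  using S(1) cn c_ge g by (auto simp: spokes_def)

lemma edge_iff: "{u, v} \<in> snd graph \<longleftrightarrow>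
    u = 0 \<and> v \<in> spokes \<or> v = 0 \<and> u \<in> spokes \<or> 1 \<le> u \<and> v = Suc u \<and> v < c \<or> 1 \<le> v \<and> u = Suc v \<and> u < c"
  unfolding graph_def snd_conv by (auto simp: doubleton_eq_iff)

lemma spoke_edge: "j \<in> spokes \<Longrightarrow> {0, j} \<in> snd graph"
  by (simp add: edge_iff)

lemma simple_graph: "simple_graph graph"
proof -
  have "{0, j} \<in> {{u, v} | u v. u \<in> {..<n} \<and> v \<in> {..<n} \<and> u \<noteq> v}" if "j \<in> spokes" for j
    using spokesD[OF that] by (intro CollectI exI[of _ 0] exI[of _ j]) auto
  moreover have "{k, Suc k} \<in> {{u, v} | u v. u \<in> {..<n} \<and> v \<in> {..<n} \<and> u \<noteq> v}" if "Suc k < c" for k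
    using that cn by (intro CollectI exI[of _ k] exI[of _ "Suc k"]) auto
  ultimately show ?thesis unfolding simple_graph_def graph_def by auto
qed

lemma connected_graph: "connected_graph graph"
proof -
  let ?R = "{(x, y). {x, y} \<in> snd graph}"
  have sym: "sym ?R" by (auto simp: sym_def insert_commute)
  have rim: "(0, k) \<in> ?R\<^sup>*" if "1 \<le> k" "k < c" for k
    using that
  proof (induction k rule: dec_induct)
    case base
    then show ?case using S(2) by (auto simp: edge_iff spokes_def)
  next
    case (step k)
    then have "(k, Suc k) \<in> ?R" by (auto simp: edge_iff)
    then show ?case using step by (meson Suc_lessD rtrancl.rtrancl_into_rtrancl)
  qed
  have hub: "(0, k) \<in> ?R\<^sup>*" if "k < n" for k
  proof -
    consider "k = 0" | "1 \<le> k" "k < c" | "c \<le> k" by linarith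
    then show ?thesis
    proof cases
      case 3
      then have "(0, k) \<in> ?R" using that by (auto simp: edge_iff spokes_def)
      then show ?thesis by blast
    qed (use rim in auto)
  qed
  have "(u, v) \<in> ?R\<^sup>*" if "u < n" "v < n" for u v
    using hub[OF that(1)] hub[OF that(2)] sym by (meson rtrancl_trans symD sym_rtrancl)
  moreover have "0 \<in> {..<n}" using c_ge g cn by simp
  ultimately show ?thesis unfolding connected_graph_def by (auto simp: graph_def)
qed

section \<open>Cycles, girth and circumference of the fan\<close>

sublocale finite_connected_graph graph
  by unfold_locales (rule simple_graph, rule connected_graph)

text \<open>The spokes need not be consecutive: the outermost pair gives a longest cycle. The length
  is \<open>v' - v + 2\<close>.\<close>

lemma polygon_cycle:
  assumes "v \<in> S" "v' \<in> S" "v < v'"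
  shows "is_cycle graph (0 # [v..<Suc v'])"
proof -
  have v: "1 \<le> v" "v' < c" using assms S(1) by auto
  have "successively (\<lambda>u v. {u, v} \<in> snd graph) [v..<Suc v']"
    unfolding successively_conv_nth using v by (auto simp: edge_iff simp del: upt_Suc)
  moreover have "{0, v} \<in> snd graph" "{v', 0} \<in> snd graph"
    using assms by (auto simp: edge_iff spokes_def)
  moreover have "hd [v..<Suc v'] = v" "last [v..<Suc v'] = v'" "[v..<Suc v'] \<noteq> []"
    using assms(3) by (auto simp: hd_upt simp del: upt_Suc)
  ultimately show ?thesis
    unfolding is_cycle_iff_successively using assms(3) v by (auto simp: successively_Cons simp del: upt_Suc)
qed

text \<open>A leaf has only the hub as neighbour. On a cycle avoiding the hub, the largest vertex
  would have only its predecessor on the rim as neighbour.\<close>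

lemma cycle_vertices:
  assumes cyc: "is_cycle graph vs"
  shows "set vs \<subseteq> {..<c}" "0 \<in> set vs"
proof -
  show "set vs \<subseteq> {..<c}"
  proof
    fix x assume "x \<in> set vs"
    then obtain y z where "y \<noteq> z" "{x, y} \<in> snd graph" "{x, z} \<in> snd graph"
      using cycle_neighbours[OF cyc] by metis
    then show "x \<in> {..<c}" using c_ge g by (auto simp: edge_iff)
  qed
  show "0 \<in> set vs"
  proof (rule ccontr)
    assume 0: "0 \<notin> set vs"
    have "set vs \<noteq> {}" using cyc by (auto simp: is_cycle_def)
    then have "Max (set vs) \<in> set vs" by simp
    then obtain y z where yz: "y \<in> set vs" "z \<in> set vs" "y \<noteq> z"
        "{Max (set vs), y} \<in> snd graph" "{Max (set vs), z} \<in> snd graph"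
      using cycle_neighbours[OF cyc] by metis
    moreover have "y \<noteq> 0" "z \<noteq> 0" "Max (set vs) \<noteq> 0" using yz(1,2) 0 \<open>Max (set vs) \<in> set vs\<close> by metis+
    moreover have "y \<le> Max (set vs)" "z \<le> Max (set vs)" using yz(1,2) by auto
    ultimately show False by (auto simp: edge_iff)
  qed
qed

lemma cycle_length_le:
  assumes "is_cycle graph vs"
  shows "length vs \<le> c"
proof -
  have "length vs = card (set vs)" using assms by (simp add: is_cycle_def distinct_card)
  also have "\<dots> \<le> card {..<c}" by (intro card_mono cycle_vertices(1)[OF assms]) simp
  finally show ?thesis by simp
qed

lemma successively_unit_steps:
  assumes "successively (\<lambda>u v. u \<le> Suc v \<and> v \<le> Suc u) (x # xs)"
  shows "last (x # xs) \<le> x + length xs \<and> x \<le> last (x # xs) + length xs"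
  using assms by (induction xs arbitrary: x) fastforce+

text \<open>Without the hub a cycle is a rim path between two different elements of
  \<open>S\<close>. Its labels change by 1 per step and these elements differ by at least
  \<open>g - 2\<close>, so it has at least \<open>g - 1\<close> vertices.\<close>

lemma cycle_length_ge:
  assumes "is_cycle graph vs"
  shows "g \<le> length vs"
proof -
  obtain ws where ws: "is_cycle graph (0 # ws)" "set (0 # ws) = set vs" "length (0 # ws) = length vs"
    using cycle_rotate_to[OF assms cycle_vertices(2)[OF assms]] by metis
  then obtain a r where r: "ws = a # r" "r \<noteq> []"
    by (cases ws rule: remdups_adj.cases) (auto simp: is_cycle_def)
  have "distinct (0 # a # r)" using ws(1) r by (simp add: is_cycle_def)
  moreover have "last r \<in> set r" using r(2) by simp
  ultimately have pos: "0 < a" "0 \<notin> set r" "a \<noteq> last r" "last r \<noteq> 0"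
    by (auto intro: gr0I)
  have lt: "x < c" if "x \<in> set (a # r)" for x
    using that cycle_vertices(1)[OF assms] ws(2) r by auto
  have "{0, a} \<in> snd graph" "{last r, 0} \<in> snd graph"
    and suc: "successively (\<lambda>u v. {u, v} \<in> snd graph) (a # r)"
    using ws(1) r by (auto simp: is_cycle_iff_successively)
  then have ab: "a \<in> S" "last r \<in> S"
    using lt[of a] lt[of "last r"] r(2) pos by (auto simp: edge_iff spokes_def)
  have "successively (\<lambda>u v. u \<le> Suc v \<and> v \<le> Suc u) (a # r)"
    using suc by (rule successively_mono) (use pos in \<open>auto simp: edge_iff\<close>)
  from successively_unit_steps[OF this] have "last r \<le> a + length r" "a \<le> last r + length r"
    using r(2) by auto
  moreover have "length vs = length r + 2" using ws(3) r by simp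
  ultimately show ?thesis using gap[OF ab] gap[OF ab(2,1)] pos(3) by linarith
qed

lemma girth: "girth graph = enat g"
  unfolding girth_def
proof (rule antisym)
  obtain s s' where s: "s \<in> S" "s' \<in> S" "s' + 2 = s + g" using exact by blast
  then have "is_cycle graph (0 # [s..<Suc s'])" using g by (intro polygon_cycle) auto
  moreover have "length (0 # [s..<Suc s']) = g" using s(3) g by (simp del: upt_Suc)
  ultimately show "(INF vs\<in>{vs. is_cycle graph vs}. enat (length vs)) \<le> enat g"
    by (metis INF_lower mem_Collect_eq)
  show "enat g \<le> (INF vs\<in>{vs. is_cycle graph vs}. enat (length vs))"
    using cycle_length_ge by (intro INF_greatest) auto
qed

lemma circumference: "circumference graph = enat c"
  unfolding circumference_def
proof (rule antisym)
  have "is_cycle graph (0 # [1..<Suc (c - 1)])"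
    using c_ge g S by (intro polygon_cycle) auto
  moreover have "length (0 # [1..<Suc (c - 1)]) = c" using c_ge g by (simp del: upt_Suc)
  ultimately show "enat c \<le> (SUP vs\<in>{vs. is_cycle graph vs}. enat (length vs))"
    by (metis SUP_upper mem_Collect_eq)
  show "(SUP vs\<in>{vs. is_cycle graph vs}. enat (length vs)) \<le> enat c"
    using cycle_length_le by (intro SUP_least) auto
qed

lemma graph_in_class: "graph \<in> graph_class g c n"
  unfolding graph_class_def using simple_graph connected_graph girth circumference
  by (simp add: graph_def)

lemma polygon_dist:
  assumes v: "v \<in> S" "v' \<in> S" "v < v'" "v' \<le> v + g"
    and p: "p \<in> segment k (Suc k)" "v \<le> k" "k < v'"
    and q: "q \<in> segment 0 v \<or> q \<in> segment 0 v' \<or> (\<exists>l. q \<in> segment l (Suc l) \<and> v \<le> l \<and> l < v')"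
  shows "graph_dist graph p q \<le> (real g + 2) / 2"
proof -
  let ?vs = "0 # [v..<Suc v']"
  have len: "length ?vs = v' - v + 2" using v(3) by (simp del: upt_Suc)
  have rim: "\<exists>t. 0 \<le> t \<and> t \<le> real (length ?vs) \<and> p = cycle_point ?vs t"
    if "p \<in> segment k (Suc k)" "v \<le> k" "k < v'" for p k
  proof -
    \<comment> \<open>The hub occupies position 0, which shifts the rim by one.\<close>
    let ?i = "Suc (k - v)"
    have "?vs ! ?i = k" "?vs ! (Suc ?i mod length ?vs) = Suc k" "?i < length ?vs"
      using that len by (auto simp: nth_append simp del: upt_Suc)
    then show ?thesis using cycle_segment[of p ?vs ?i] that(1) by metis
  qed
  have spoke: "\<exists>t. 0 \<le> t \<and> t \<le> real (length ?vs) \<and> p = cycle_point ?vs t"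
    if "p \<in> segment 0 v \<or> p \<in> segment 0 v'" for p
    using that
  proof
    assume p: "p \<in> segment 0 v"
    have "?vs ! 0 = 0" "?vs ! (Suc 0 mod length ?vs) = v" "0 < length ?vs"
      using len v(3) by (auto simp del: upt_Suc)
    then show ?thesis using cycle_segment[of p ?vs 0] p by metis
  next
    assume p: "p \<in> segment 0 v'"
    let ?i = "Suc (v' - v)"
    have "?vs ! ?i = v'" "?vs ! (Suc ?i mod length ?vs) = 0" "?i < length ?vs"
      using len v(3) by (auto simp del: upt_Suc)
    then show ?thesis using cycle_segment[of p ?vs ?i] p segment_commute[of 0 v'] by metis
  qed
  obtain s t where "0 \<le> s" "s \<le> real (length ?vs)" "p = cycle_point ?vs s"
      "0 \<le> t" "t \<le> real (length ?vs)" "q = cycle_point ?vs t"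
    using rim[OF p] rim[of q] spoke[of q] q by blast
  then have "graph_dist graph p q \<le> real (length ?vs) / 2"
    using graph_dist_cycle_half[OF polygon_cycle[OF v(1-3)]] by simp
  also have "\<dots> \<le> (real g + 2) / 2" unfolding len using v by simp
  finally show ?thesis .
qed

text \<open>The potential of \<open>side j\<close> vanishes exactly on the spoke to \<open>j\<close>, which therefore separates
  the points with smaller from those with larger rim coordinate.\<close>

definition side :: "nat \<Rightarrow> nat \<Rightarrow> real" where
  "side j k = (if k = 0 \<or> k = j then 0 else if k < j then -1 else 1)"

text \<open>Weak inequalities let points on the spoke count for both sides; hence
  \<open>separates_cases\<close> also holds for a third point on the spoke.\<close>

definition separates :: "nat \<Rightarrow> (nat \<Rightarrow> real) \<Rightarrow> (nat \<Rightarrow> real) \<Rightarrow> bool" where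
  "separates j x y \<longleftrightarrow> potential graph (side j) x \<le> 0 \<and> 0 \<le> potential graph (side j) y \<or>
     potential graph (side j) y \<le> 0 \<and> 0 \<le> potential graph (side j) x"

lemma side_lipschitz: "{u, v} \<in> snd graph \<Longrightarrow> \<bar>side j u - side j v\<bar> \<le> 1"
  by (auto simp: edge_iff side_def)

lemma point_cases:
  assumes "p \<in> graph_points graph"
  obtains j where "j \<in> spokes" "p \<in> segment 0 j"
    | k where "1 \<le> k" "Suc k < c" "p \<in> segment k (Suc k)"
  using assms
proof (cases rule: graph_pointsE)
  case (1 v)
  then have v: "v < n" by (simp add: graph_def)
  have right: "p \<in> segment 0 v" and left: "p \<in> segment v w" for w
    unfolding 1 by (rule right_in_segment left_in_segment)+
  \<comment> \<open>The hub, the last rim vertex and the leaves are placed on spokes, every other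
    vertex on the rim edge to its successor.\<close>
  have "v = 0 \<or> v = c - 1 \<or> c \<le> v \<or> 1 \<le> v \<and> Suc v < c" by linarith
  then consider "v = 0" | "v \<in> spokes" | "1 \<le> v" "Suc v < c"
    using v S(3) by (auto simp: spokes_def)
  then show ?thesis
  proof cases
    case 1
    then show ?thesis using that(1)[of 1] left[of 1] S(2) by (simp add: spokes_def)
  qed (use that left right in blast)+
next
  case (2 u v)
  then show ?thesis using that segment_commute unfolding edge_iff by metis
qed

lemma potential_side_zero:
  assumes "q \<in> graph_points graph" "j \<in> spokes" and zero: "potential graph (side j) q = 0"
  shows "q \<in> segment 0 j"
  using assms(1)
proof (cases rule: point_cases)
  case (1 i)
  then obtain t where t: "0 \<le> t" "t \<le> 1" "q = edge_point 0 i t" by (meson segmentE)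
  then have "potential graph (side j) q = t * side j i"
    using edgeD[OF spoke_edge[OF 1(1)]] by (simp add: potential_edge_point side_def)
  then have "t = 0 \<or> i = j" using zero spokesD[OF 1(1)] by (auto simp: side_def split: if_splits)
  then show ?thesis
  proof
    assume "t = 0"
    then have "q = edge_point 0 j 0" using t(3) edge_point_0 by metis
    then show ?thesis unfolding segment_def by auto
  qed (use 1 in simp)
next
  case (2 k)
  then obtain t where t: "0 \<le> t" "t \<le> 1" "q = edge_point k (Suc k) t" by (meson segmentE)
  have e: "{k, Suc k} \<in> snd graph" using 2 by (simp add: edge_iff)
  have z: "(1 - t) * side j k + t * side j (Suc k) = 0"
    using zero t(3) edgeD[OF e] by (simp add: potential_edge_point)
  \<comment> \<open>If \<open>j\<close> is not an end of the rim edge, both ends carry the same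
    nonzero value, so the potential has no zero there.\<close>
  consider "k = j" | "Suc k = j" | "Suc k < j" | "j < k" by linarith
  then have "q = edge_point j j 0"
  proof cases
    case 1
    then have "t = 0" using z 2(1) by (simp add: side_def)
    then show ?thesis using t(3) 1 edge_point_0 by metis
  next
    case 2
    then have "t = 1" using z \<open>1 \<le> k\<close> by (auto simp: side_def)
    then show ?thesis using t(3) 2 edge_point_1 by metis
  qed (use z 2(1) in \<open>auto simp: side_def\<close>)
  then have "q = edge_point 0 j 1" using edge_point_1 by metis
  then show ?thesis unfolding segment_def by auto
qed

lemma potential_side_sign:
  assumes "{u, v} \<in> snd graph" "p \<in> segment u v"
  shows "u \<le> j \<Longrightarrow> v \<le> j \<Longrightarrow> potential graph (side j) p \<le> 0"
    and "u = 0 \<or> j \<le> u \<Longrightarrow> v = 0 \<or> j \<le> v \<Longrightarrow> 0 \<le> potential graph (side j) p"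
proof -
  obtain t where t: "0 \<le> t" "t \<le> 1" "p = edge_point u v t" using assms(2) by (rule segmentE)
  have pot: "potential graph (side j) p = (1 - t) * side j u + t * side j v"
    unfolding t(3) using edgeD[OF assms(1)] by (intro potential_edge_point)
  show "potential graph (side j) p \<le> 0" if "u \<le> j" "v \<le> j"
    unfolding pot using t(1,2) that
    by (intro add_nonpos_nonpos mult_nonneg_nonpos) (auto simp: side_def)
  show "0 \<le> potential graph (side j) p" if "u = 0 \<or> j \<le> u" "v = 0 \<or> j \<le> v"
    unfolding pot using t(1,2) that
    by (intro add_nonneg_nonneg mult_nonneg_nonneg) (auto simp: side_def)
qed

text \<open>Unless \<open>x\<close> is on a spoke, it lies on the rim of a polygon of length at most
  \<open>g + 2\<close>. Either \<open>y\<close> is on that polygon too, or a bounding spoke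
  separates the points, and all of this spoke is within half the polygon of
  \<open>x\<close>.\<close>

lemma separating_spoke:
  assumes "x \<in> graph_points graph" "y \<in> graph_points graph"
  shows "graph_dist graph x y \<le> (real g + 2) / 2 \<or> (\<exists>j\<in>spokes. x \<in> segment 0 j) \<or>
    (\<exists>j\<in>spokes. separates j x y \<and> (\<forall>q\<in>segment 0 j. graph_dist graph x q \<le> (real g + 2) / 2))"
  using assms(1)
proof (cases rule: point_cases)
  case (1 j)
  then show ?thesis by blast
next
  case (2 k)
  obtain v v' where v: "v \<in> S" "v' \<in> S" "v \<le> k" "k < v'" "v' \<le> v + g" using cover[OF 2(1,2)] by blast
  have near: "graph_dist graph x q \<le> (real g + 2) / 2"
    if "q \<in> segment 0 v \<or> q \<in> segment 0 v' \<or> (\<exists>l. q \<in> segment l (Suc l) \<and> v \<le> l \<and> l < v')" for q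
    using v 2(3) that by (intro polygon_dist[of v v' x k q]) auto
  have e: "{k, Suc k} \<in> snd graph" using 2 by (simp add: edge_iff)
  have x_le: "potential graph (side v') x \<le> 0" using potential_side_sign(1)[OF e 2(3)] v by simp
  have x_ge: "0 \<le> potential graph (side v) x" using potential_side_sign(2)[OF e 2(3)] v by simp
  have left: ?thesis if "potential graph (side v) y \<le> 0"
    using near that x_ge v(1) by (auto simp: separates_def spokes_def)
  have right: ?thesis if "0 \<le> potential graph (side v') y"
    using near that x_le v(2) by (auto simp: separates_def spokes_def)
  show ?thesis using assms(2)
  proof (cases rule: point_cases)
    case (1 j)
    \<comment> \<open>A spoke strictly between would need
      \<open>2 * (g - 2) \<le> v' - v \<le> g\<close>, impossible for \<open>g \<ge> 5\<close>. So
      \<open>v\<close> and \<open>v'\<close> are consecutive.\<close>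
    have "j \<le> v \<or> v' \<le> j"
    proof (rule ccontr)
      assume *: "\<not> (j \<le> v \<or> v' \<le> j)"
      moreover have "v' < c" using v(2) S(1) by auto
      ultimately have "j \<in> S" using 1(1) by (auto simp: spokes_def)
      with gap[OF v(1) this] gap[OF this v(2)] * v(5) g show False by linarith
    qed
    then show ?thesis
      using left right potential_side_sign(1)[OF spoke_edge[OF 1(1)] 1(2), of v]
        potential_side_sign(2)[OF spoke_edge[OF 1(1)] 1(2), of v'] by blast
  next
    case (2 l)
    have l: "{l, Suc l} \<in> snd graph" using 2 by (simp add: edge_iff)
    consider "Suc l \<le> v" | "v \<le> l" "l < v'" | "v' \<le> l" by linarith
    then show ?thesis
    proof cases
      case 1
      then show ?thesis using potential_side_sign(1)[OF l 2(3)] by (intro left) auto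
    next
      case 2
      then show ?thesis using near[of y] \<open>y \<in> segment l (Suc l)\<close> by blast
    next
      case 3
      then show ?thesis using potential_side_sign(2)[OF l 2(3)] by (intro right) auto
    qed
  qed
qed

section \<open>Geodesic triangles in the fan\<close>

lemma geodesic_crosses_spoke:
  assumes "geodesic (graph_points graph) (graph_dist graph) x y A"
    and "x \<in> graph_points graph" "y \<in> graph_points graph" "j \<in> spokes" "separates j x y"
  shows "\<exists>q\<in>A. q \<in> segment 0 j"
proof -
  have "\<exists>q\<in>A. potential graph (side j) q = 0"
  proof (rule geodesic_zero[OF assms(1)])
    show "0 \<le> graph_dist graph x y" by (rule graph_dist_nonneg[OF assms(2,3)])
    show "\<bar>potential graph (side j) p - potential graph (side j) q\<bar> \<le> graph_dist graph p q"
      if "p \<in> graph_points graph" "q \<in> graph_points graph" for p q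
      using that by (rule potential_lipschitz) (rule side_lipschitz)
  qed (use assms(5) in \<open>simp add: separates_def\<close>)
  then show ?thesis using geodesic_subset[OF assms(1)] potential_side_zero[OF _ assms(4)] by blast
qed

text \<open>The third corner lies weakly on one side of the spoke, so one of the other two sides of
  the triangle must cross it too.\<close>

lemma separates_cases: "separates j x y \<Longrightarrow> separates j y z \<or> separates j z x"
  unfolding separates_def by linarith

lemma separates_commute: "separates j x y \<longleftrightarrow> separates j y x"
  unfolding separates_def by blast

text \<open>\<open>T\<close> stands for the union of the other two sides. If \<open>x\<close> itself
  is on a spoke, it serves as both crossing points.\<close>

lemma crossing_pair:
  assumes "x \<in> graph_points graph" "y \<in> graph_points graph" "x \<in> A" "x \<in> T"
    and "\<And>j. j \<in> spokes \<Longrightarrow> separates j x y \<Longrightarrow> \<exists>q\<in>A. q \<in> segment 0 j"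
    and "\<And>j. j \<in> spokes \<Longrightarrow> separates j x y \<Longrightarrow> \<exists>q\<in>T. q \<in> segment 0 j"
    and far: "(real g + 2) / 2 < graph_dist graph x y"
  shows "\<exists>q\<in>A. \<exists>q'\<in>T. \<exists>j\<in>spokes. q \<in> segment 0 j \<and> q' \<in> segment 0 j \<and>
           graph_dist graph x q \<le> (real g + 2) / 2"
proof -
  consider j where "j \<in> spokes" "x \<in> segment 0 j"
    | j where "j \<in> spokes" "separates j x y" "\<forall>q\<in>segment 0 j. graph_dist graph x q \<le> (real g + 2) / 2"
    using separating_spoke[OF assms(1,2)] far by fastforce
  then show ?thesis
  proof cases
    case 1
    have "graph_dist graph x x \<le> (real g + 2) / 2" using graph_dist_self[OF assms(1)] by simp
    then show ?thesis using 1 assms(3,4) by blast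
  next
    case 2
    then show ?thesis using assms(5,6) by meson
  qed
qed

lemma graph_delta_le: "graph_delta graph \<le> (real g + 4) / 4"
proof (rule graph_delta_le)
  fix A B C x y z p
  assume x: "x \<in> graph_points graph" and y: "y \<in> graph_points graph" and z: "z \<in> graph_points graph"
    and A: "geodesic (graph_points graph) (graph_dist graph) x y A"
    and B: "geodesic (graph_points graph) (graph_dist graph) y z B"
    and C: "geodesic (graph_points graph) (graph_dist graph) z x C" and "p \<in> A"
  let ?d = "graph_dist graph" and ?D = "graph_dist graph x y" and ?r = "(real g + 4) / 4"
  have nn: "0 \<le> ?d x y" "0 \<le> ?d y z" "0 \<le> ?d z x" using x y z graph_dist_nonneg by auto
  note ends = geodesic_ends[OF A, OF nn(1)] geodesic_ends[OF B, OF nn(2)] geodesic_ends[OF C, OF nn(3)]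
  have sub: "A \<subseteq> graph_points graph" "B \<union> C \<subseteq> graph_points graph"
    using geodesic_subset[OF A] geodesic_subset[OF B] geodesic_subset[OF C] by auto
  obtain \<gamma> where \<gamma>: "\<gamma> 0 = x" "\<gamma> ?D = y" "\<gamma> ` {0..?D} = A"
    and iso: "\<And>s t. s \<in> {0..?D} \<Longrightarrow> t \<in> {0..?D} \<Longrightarrow> ?d (\<gamma> s) (\<gamma> t) = \<bar>s - t\<bar>"
    using A unfolding geodesic_def by blast
  obtain s where s: "s \<in> {0..?D}" "p = \<gamma> s" using \<open>p \<in> A\<close> \<gamma>(3) by blast
  have dx: "?d (\<gamma> t) x = t" and dy: "?d (\<gamma> t) y = ?D - t" if "t \<in> {0..?D}" for t
    using iso[OF that, of 0] iso[OF that, of ?D] that nn(1) \<gamma>(1,2) by auto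
  show "\<exists>q\<in>B \<union> C. ?d p q \<le> ?r"
  proof (rule ccontr)
    assume "\<not> ?thesis"
    then have far: "?r < ?d p q" if "q \<in> B \<union> C" for q using that by force
    \<comment> \<open>The corners \<open>x\<close> and \<open>y\<close> belong to
      \<open>B \<union> C\<close>, so \<open>p\<close> is far from both.\<close>
    have sx: "?r < s" and sy: "?r < ?D - s" using far[of x] far[of y] ends dx[OF s(1)] dy[OF s(1)] s(2) by auto
    then have D: "(real g + 2) / 2 < ?D" by simp
    have crossA: "\<exists>q\<in>A. q \<in> segment 0 j" if "j \<in> spokes" "separates j x y" for j
      using geodesic_crosses_spoke[OF A x y that] .
    have crossT: "\<exists>q\<in>B \<union> C. q \<in> segment 0 j" if "j \<in> spokes" "separates j x y" for j
      using separates_cases[OF that(2), of z] geodesic_crosses_spoke[OF B y z that(1)]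
        geodesic_crosses_spoke[OF C z x that(1)] by blast
    have pair: "\<bar>s - t\<bar> + 1 > ?r" if "t \<in> {0..?D}" "\<gamma> t \<in> segment 0 j" "q' \<in> B \<union> C" "q' \<in> segment 0 j"
      "j \<in> spokes" for t q' j
    proof -
      have "\<gamma> t \<in> graph_points graph" "p \<in> graph_points graph" "q' \<in> graph_points graph"
        using that \<gamma>(3) sub \<open>p \<in> A\<close> by auto
      then have "?d p q' \<le> ?d p (\<gamma> t) + ?d (\<gamma> t) q'" by (intro graph_dist_triangle)
      moreover have "?d (\<gamma> t) q' \<le> 1" using that spoke_edge by (intro graph_dist_segment) auto
      ultimately show ?thesis using far[OF that(3)] iso[OF s(1) that(1)] unfolding s(2) by linarith
    qed
    obtain q1 q1' j1 where "q1 \<in> A" and 1: "q1' \<in> B \<union> C" "j1 \<in> spokes" "q1 \<in> segment 0 j1" "q1' \<in> segment 0 j1"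
        "?d x q1 \<le> (real g + 2) / 2"
      using crossing_pair[OF x y ends(1) _ crossA crossT D] ends by blast
    then obtain s1 where s1: "s1 \<in> {0..?D}" "q1 = \<gamma> s1" using \<gamma>(3) by blast
    obtain q2 q2' j2 where "q2 \<in> A" and 2: "q2' \<in> B \<union> C" "j2 \<in> spokes" "q2 \<in> segment 0 j2" "q2' \<in> segment 0 j2"
        "?d y q2 \<le> (real g + 2) / 2"
      using crossing_pair[OF y x ends(2), of "B \<union> C"] crossA crossT D ends
      unfolding separates_commute[of _ y x] graph_dist_commute[of graph y x] by blast
    then obtain s2 where s2: "s2 \<in> {0..?D}" "q2 = \<gamma> s2" using \<gamma>(3) by blast
    let ?h = "edge_point 0 0 0"
    have h: "?h \<in> graph_points graph" using segment_subset[OF spoke_edge[OF 1(2)]] left_in_segment[of 0] by blast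
    have "?d q1 ?h \<le> 1" "?d ?h q2 \<le> 1"
      using graph_dist_segment[OF spoke_edge[OF 1(2)] 1(3) left_in_segment]
        graph_dist_segment[OF spoke_edge[OF 2(2)] left_in_segment 2(3)] by auto
    moreover have "?d q1 q2 \<le> ?d q1 ?h + ?d ?h q2"
      using \<open>q1 \<in> A\<close> \<open>q2 \<in> A\<close> sub h by (intro graph_dist_triangle) auto
    \<comment> \<open>Both crossings are within 1 of the hub, where all spokes meet.\<close>
    ultimately have "\<bar>s1 - s2\<bar> \<le> 2" using iso[OF s1(1) s2(1)] unfolding s1(2) s2(2) by linarith
    moreover have "s1 \<le> (real g + 2) / 2" "?D - s2 \<le> (real g + 2) / 2"
      using 1(5) 2(5) dx[OF s1(1)] dy[OF s2(1)] s1(2) s2(2) graph_dist_commute[of graph] by metis+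
    moreover have "\<bar>s - s1\<bar> + 1 > ?r" "\<bar>s - s2\<bar> + 1 > ?r"
      using pair[OF s1(1) _ 1(1,4,2)] pair[OF s2(1) _ 2(1,4,2)] 1(3) 2(3) s1(2) s2(2) by auto
    \<comment> \<open>If \<open>s \<le> s1\<close>, then
      \<open>s1 > 2 * ?r - 1 = (g + 2) / 2\<close>, a contradiction; so \<open>s1 < s\<close>, and
      symmetrically \<open>s < s2\<close>. Then \<open>s2 - s1 > 2 * ?r - 2 = g / 2 > 2\<close>, a
      contradiction.\<close>
    ultimately show False using sx sy g by (simp add: abs_if field_simps split: if_splits)
  qed
qed simp

end

section \<open>Existence of fans\<close>

text \<open>Under these bounds \<open>N\<close> is a sum of \<open>k\<close> numbers among
  \<open>m\<close>, \<open>m + 1\<close>, \<open>m + 2\<close>; the partial sums, shifted by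
  \<open>a\<close>, form the set.\<close>

lemma gap_set_exists:
  assumes "m * k \<le> N" "N \<le> (m + 2) * k" "1 \<le> m"
  shows "\<exists>S. S \<subseteq> {a..a + N} \<and> a \<in> S \<and> a + N \<in> S \<and> (\<forall>s\<in>S. \<forall>s'\<in>S. s < s' \<longrightarrow> s + m \<le> s') \<and>
    (\<forall>x. a \<le> x \<and> x < a + N \<longrightarrow> (\<exists>v\<in>S. \<exists>v'\<in>S. v \<le> x \<and> x < v' \<and> v' \<le> v + m + (2::nat)))"
  using assms(1,2)
proof (induction k arbitrary: a N)
  case 0
  then show ?case by (intro exI[of _ "{a}"]) auto
next
  case (Suc k)
  \<comment> \<open>The least first summand from \<open>m\<close> on that leaves at most
    \<open>(m + 2) * k\<close> for the other \<open>k\<close> summands.\<close>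
  define h where "h = max m (N - (m + 2) * k)"
  have "m * k \<le> (m + 2) * k" by simp
  then have h: "m \<le> h" "h \<le> m + 2" "h \<le> N" "m * k \<le> N - h" "N - h \<le> (m + 2) * k"
    using Suc.prems unfolding h_def mult_Suc_right by linarith+
  obtain S where S: "S \<subseteq> {a + h..a + h + (N - h)}" "a + h \<in> S" "a + h + (N - h) \<in> S"
      "\<forall>s\<in>S. \<forall>s'\<in>S. s < s' \<longrightarrow> s + m \<le> s'"
      "\<forall>x. a + h \<le> x \<and> x < a + h + (N - h) \<longrightarrow> (\<exists>v\<in>S. \<exists>v'\<in>S. v \<le> x \<and> x < v' \<and> v' \<le> v + m + 2)"
    using Suc.IH[OF h(4,5), of "a + h"] by blast
  have N: "a + h + (N - h) = a + N" using h by simp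
  note S = S[unfolded N]
  show ?case
  proof (intro exI[of _ "insert a S"] conjI allI impI ballI)
    fix s s' assume "s \<in> insert a S" "s' \<in> insert a S" "s < s'"
    then show "s + m \<le> s'" using S(1,4) h(1) by fastforce
  next
    fix x assume x: "a \<le> x \<and> x < a + N"
    show "\<exists>v\<in>insert a S. \<exists>v'\<in>insert a S. v \<le> x \<and> x < v' \<and> v' \<le> v + m + 2"
    proof (cases "x < a + h")
      case True
      then show ?thesis using x S(2) h(2) by (intro bexI[of _ a] bexI[of _ "a + h"]) auto
    next
      case False
      then show ?thesis using S(5) x by (meson insertI2 not_less)
    qed
  qed (use S h in auto)
qed

lemma fan_exists:
  assumes "5 \<le> g" "g \<le> c" "c \<le> n" "2 * int c \<ge> (int g)\<^sup>2 - 2 * int g + 4"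
  shows "\<exists>S. fan g c n S"
proof -
  \<comment> \<open>A polygon of length \<open>g\<close> takes \<open>m\<close> rim edges. One is
    set aside to realise the girth; of the \<open>c - 2\<close> rim edges \<open>N\<close> remain,
    to be split into \<open>k\<close> pieces.\<close>
  define m where "m = g - 2"
  define N where "N = c - g"
  define k where "k = N div m"
  have gm: "g = m + 2" and c: "c = N + m + 2" using assms by (auto simp: m_def N_def)
  have "int (m * m) \<le> int (2 * N)"
    using assms(4) unfolding gm c by (simp add: power2_eq_square algebra_simps)
  \<comment> \<open>This is the hypothesis on \<open>c\<close>, rewritten in \<open>m\<close> and
    \<open>N\<close>.\<close>
  then have mN: "m * m \<le> 2 * N" by linarith
  have N: "N = m * k + N mod m" "N mod m < m" using assms(1) by (auto simp: k_def m_def)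
  \<comment> \<open>Each of the \<open>k\<close> pieces can absorb at most 2 edges of the
    remainder.\<close>
  have "N mod m \<le> 2 * k"
  proof (rule ccontr)
    assume "\<not> ?thesis"
    then have "2 * k + 2 \<le> m" using N(2) by linarith
    then have "m * (2 * k + 2) \<le> m * m" by (rule mult_le_mono2)
    also have "\<dots> \<le> 2 * (m * k + N mod m)" using mN N(1) by simp
    finally show False using N(2) by (simp add: algebra_simps)
  qed
  then have "m * k \<le> N" "N \<le> (m + 2) * k" using N(1) by (simp_all add: algebra_simps)
  from gap_set_exists[OF this, of "m + 1"] obtain S where
    S: "S \<subseteq> {m + 1..m + 1 + N}" "m + 1 \<in> S" "m + 1 + N \<in> S"
      "\<forall>s\<in>S. \<forall>s'\<in>S. s < s' \<longrightarrow> s + m \<le> s'"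
      "\<forall>x. m + 1 \<le> x \<and> x < m + 1 + N \<longrightarrow> (\<exists>v\<in>S. \<exists>v'\<in>S. v \<le> x \<and> x < v' \<and> v' \<le> v + m + 2)"
    using assms(1) gm by auto
  \<comment> \<open>\<open>S\<close> starts at \<open>m + 1\<close>, so adding 1 puts the reserved
    polygon of length \<open>g\<close> in front.\<close>
  have "fan g c n (insert 1 S)"
  proof
    show "5 \<le> g" "c \<le> n" by fact+
    show "insert 1 S \<subseteq> {1..<c}" using S(1) assms(1) unfolding gm c by auto
    show "1 \<in> insert 1 S" by simp
    show "c - 1 \<in> insert 1 S" using S(3) unfolding c by (simp add: add_ac)
    show "\<exists>s\<in>insert 1 S. \<exists>s'\<in>insert 1 S. s' + 2 = s + g"
      using S(2) unfolding gm by (intro bexI[of _ 1] bexI[of _ "m + 1"]) auto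
    fix s s' assume "s \<in> insert 1 S" "s' \<in> insert 1 S" "s < s'"
    then show "s + g \<le> s' + 2" using S(1,4) unfolding gm by fastforce
  next
    fix x assume x: "1 \<le> x" "Suc x < c"
    show "\<exists>v\<in>insert 1 S. \<exists>v'\<in>insert 1 S. v \<le> x \<and> x < v' \<and> v' \<le> v + g"
    proof (cases "x < m + 1")
      case True
      then show ?thesis using x S(2) unfolding gm by (intro bexI[of _ 1] bexI[of _ "m + 1"]) auto
    next
      case False
      then have "\<exists>v\<in>S. \<exists>v'\<in>S. v \<le> x \<and> x < v' \<and> v' \<le> v + m + 2" using S(5) x unfolding c by simp
      then show ?thesis unfolding gm by (metis add.assoc insertI2)
    qed
  qed
  then show ?thesis by blast
qed

theorem theorem3p12:
  fixes g c n :: nat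
  assumes "v_admissible g c n"
    and "5 \<le> g" and "g \<le> c" and "c \<le> n"
    and "2 * int c \<ge> (int g)\<^sup>2 - 2 * int g + 4"
  shows "(even g \<longrightarrow> real g / 4 \<le> min_delta g c n \<and> min_delta g c n \<le> (real g + 4) / 4) \<and>
         (odd g \<longrightarrow> real g / 4 \<le> min_delta g c n \<and> min_delta g c n \<le> (real g + 5) / 4)"
proof -
  \<comment> \<open>The class is finite and nonempty, so the minimum is attained; the lower bound is
    applied to a minimiser.\<close>
  have "min_delta g c n \<in> graph_delta ` graph_class g c n"
    unfolding min_delta_def using finite_graph_class assms(1) by (intro Min_in) (auto simp: v_admissible_def)
  then obtain G where G: "G \<in> graph_class g c n" "min_delta g c n = graph_delta G" by blast
  then interpret finite_connected_graph G by unfold_locales (auto simp: graph_class_def)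
  obtain vs where vs: "is_cycle G vs" "length vs = g" "\<And>ws. is_cycle G ws \<Longrightarrow> g \<le> length ws"
    using G(1) by (auto simp: graph_class_def elim: girth_attained)
  then have lower: "real g / 4 \<le> min_delta g c n"
    using graph_delta_ge_shortest_cycle[of vs] G(2) assms(2) by simp
  obtain S where "fan g c n S" using fan_exists[OF assms(2-5)] by blast
  then interpret fan: fan g c n S .
  have "min_delta g c n \<le> graph_delta fan.graph"
    unfolding min_delta_def using finite_graph_class fan.graph_in_class by (intro Min_le) auto
  also have "\<dots> \<le> (real g + 4) / 4" by (rule fan.graph_delta_le)
  finally show ?thesis using lower by simp
qed

end
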